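(* (a) If $\Xi$ is a left-variant or right-variant scalar FQ operation which is orthogonally invariant and has constant term $\tilde p^{[0]}=1$, then $\Xi$ is the constant operation $1$. (c) If $\Xi$ is a left-variant pseudoscalar FQ operation which is orthogonally invariant and has constant term $\tilde p^{[12]}=1$, then $\Xi=\mathcal A_L$, the expansion around $(Q_1,Q_2)$ of $\mathcal A_L(A_1,A_2)=-\mathrm{pol}(A_1A_2^{-1})$. (c') If $\Xi$ is a right-variant pseudoscalar FQ operation which is orthogonally invariant and has constant term $\tilde p^{[12]}=1$, then $\Xi=\mathcal A_R$, the expansion around $(Q_1,Q_2)$ of $\mathcal A_R(A_1,A_2)=-\mathrm{pol}(A_1^{-1}A_2)$.
   Context: Setting. $(Q_1,Q_2)$ is a Clifford system: $Q_1^2=Q_2^2=-1$, $Q_1Q_2=-Q_2Q_1$. $R_1,R_2$ are formal noncommuting infinitesimal variables; one works in the real algebra generated by $Q_1,Q_2,R_1,R_2$ (free apart from the Clifford relations), completed with respect to total degree in $R_1,R_2$, or in extensions of it by further formal infinitesimal elements. Put $A_i=Q_i+R_i$. For $Q$ with $Q^2=-1$ and any $X$ put $X^0_Q=\frac12(X+Q^{-1}XQ)$, $X^1_Q=\frac12(X-Q^{-1}XQ)$. The split variables are $r_1,\dots,r_8$: for $j\in\{1,2\}$, $\iota_1,\iota_2\in\{0,1\}$, $r_{4(j-1)+2\iota_1+\iota_2+1}=((R_jQ_j^{-1})^{\iota_1}_{Q_1})^{\iota_2}_{Q_2}$. An FQ operation around $(Q_1,Q_2)$ is given by formal real noncommutative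 power series in eight variables: scalar $\Xi(A_1,A_2)=f_0(r_1,\dots,r_8)$, vectorial $\Xi(A_1,A_2)=(f_1(r)Q_1,f_2(r)Q_2)$, pseudoscalar $\Xi(A_1,A_2)=f_{12}(r)Q_1Q_2$; the operation is identified with this family of series. The same series can be evaluated relative to any other Clifford system $(Q_1',Q_2')$ at $(A_1',A_2')$ with $A'_i-Q'_i$ infinitesimal, by forming the split variables of $A_i'-Q_i'$ relative to $(Q'_1,Q'_2)$ and multiplying by $Q'_s$. The circular-basis constant term $\tilde p^{[s]}$ is simply the constant term of $f_s$. Orthogonal invariance: let $t$ be a central formal variable with $t^2=0$ and $\mathrm{Rot}_t(B_1,B_2)=(B_1+tB_2,\,B_2-tB_1)$. A (pseudo)scalar $\Xi$ is orthogonally invariant if $\Xi_{(Q_1,Q_2)}(A_1,A_2)=\Xi_{\mathrm{Rot}_t(Q_1,Q_2)}(\mathrm{Rot}_t(A_1,A_2))$, the subscript indicating the base Clifford system. Variance: with $\theta_1,\theta_2$ of the form $1+\epsilon$, $\epsilon$ a formal infinitesimal, and $\Xi$ evaluated around the fixed base $(Q_1,Q_2)$: $\Xi$ is left-variant if $\Xi(\theta_1A_1\theta_2,\theta_1A_2\theta_2)=\theta_1\Xi(A_1,A_2)\theta_1^{-1}$, right-variant if $\Xi(\theta_1A_1\theta_2,\theta_1A_2\theta_2)=\theta_2^{-1}\Xi(A_1,A_2)\theta_2$. For $X$ infinitesimally close to an element squaring to $-1$, $\mathrm{pol}\,X=X(-X^2)^{-1/2}$, the inverse square root given by the binomial power series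 around $1$. *)

theory Defs
  imports Complex_Main
begin

text \<open>Concrete model of the completed real algebra generated by a Clifford system
(Q1,Q2), by countably many free noncommuting formal infinitesimal variables
(var 0 = R1, var 1 = R2, var 2, var 3, ... used as further infinitesimals), and by a
central element t with t^2 = 0.  Clifford basis elements are Q1^a Q2^b, indexed by
(a,b) :: bool * bool.  A monomial is (tflag, h0, [(k1,h1),...,(kn,hn)]) standing for
t^tflag * h0 * x_k1 * h1 * ... * x_kn * hn.  An element is an arbitrary real coefficient
function on monomials (completion w.r.t. the degree n in the variables).\<close>

type_synonym bas = "bool \<times> bool"
type_synonym mon = "bool \<times> bas \<times> (nat \<times> bas) list"
type_synonym alg = "mon \<Rightarrow> real"

definition bas_mul :: "bas \<Rightarrow> bas \<Rightarrow> real \<times> bas" where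
  "bas_mul x y =
     (let a = fst x; b = snd x; c = fst y; d = snd y
      in ((if (b \<and> c) \<noteq> ((a \<and> c) \<noteq> (b \<and> d)) then -1 else 1), (a \<noteq> c, b \<noteq> d)))"

definition mon_mul :: "mon \<Rightarrow> mon \<Rightarrow> real \<times> mon" where
  "mon_mul m n =
     (case m of (t1, h, ws) \<Rightarrow> case n of (t2, g, vs) \<Rightarrow>
        (let z = (if t1 \<and> t2 then 0 else 1) in
         if ws = [] then
           (let p = bas_mul h g in (z * fst p, (t1 \<or> t2, snd p, vs)))
         else
           (let k = fst (last ws); p = bas_mul (snd (last ws)) g in
            (z * fst p, (t1 \<or> t2, h, butlast ws @ [(k, snd p)] @ vs)))))"

definition deg :: "mon \<Rightarrow> nat" where
  "deg m = length (snd (snd m))"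

definition amon :: "mon \<Rightarrow> alg" where
  "amon m = (\<lambda>m'. if m' = m then 1 else 0)"

definition aadd :: "alg \<Rightarrow> alg \<Rightarrow> alg" (infixl "\<oplus>" 65) where
  "x \<oplus> y = (\<lambda>m. x m + y m)"

definition aneg :: "alg \<Rightarrow> alg" where
  "aneg x = (\<lambda>m. - x m)"

definition asub :: "alg \<Rightarrow> alg \<Rightarrow> alg" (infixl "\<ominus>" 65) where
  "x \<ominus> y = (\<lambda>m. x m - y m)"

definition ascale :: "real \<Rightarrow> alg \<Rightarrow> alg" where
  "ascale c x = (\<lambda>m. c * x m)"

definition amul :: "alg \<Rightarrow> alg \<Rightarrow> alg" (infixl "\<otimes>" 70) where
  "x \<otimes> y = (\<lambda>m. \<Sum>p \<in> {p. snd (mon_mul (fst p) (snd p)) = m}.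
                     fst (mon_mul (fst p) (snd p)) * x (fst p) * y (snd p))"

definition aone :: alg where "aone = amon (False, (False, False), [])"
definition aQ1 :: alg where "aQ1 = amon (False, (True, False), [])"
definition aQ2 :: alg where "aQ2 = amon (False, (False, True), [])"
definition tt :: alg where "tt = amon (True, (False, False), [])"
definition var :: "nat \<Rightarrow> alg" where
  "var k = amon (False, (False, False), [(k, (False, False))])"

definition infinitesimal :: "alg \<Rightarrow> bool" where
  "infinitesimal x \<longleftrightarrow> (\<forall>m. deg m = 0 \<longrightarrow> x m = 0)"

definition aprod_list :: "alg list \<Rightarrow> alg" where
  "aprod_list xs = foldr amul xs aone"

definition apow :: "alg \<Rightarrow> nat \<Rightarrow> alg" where
  "apow x n = aprod_list (replicate n x)"

definition ainv :: "alg \<Rightarrow> alg" where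
  "ainv x = (THE y. x \<otimes> y = aone \<and> y \<otimes> x = aone)"

text \<open>One-variable series sum c_n x^n at an infinitesimal x: since x^n only has monomials
of degree >= n, the coefficient at a monomial m only involves n <= deg m.\<close>
definition ser1 :: "(nat \<Rightarrow> real) \<Rightarrow> alg \<Rightarrow> alg" where
  "ser1 c x = (\<lambda>m. \<Sum>n\<le>deg m. c n * apow x n m)"

text \<open>A noncommutative formal power series in eight variables r_1..r_8 (encoded by the
letters 0..7) is a coefficient function on words; evaluation at infinitesimals.\<close>
type_synonym ncser = "nat list \<Rightarrow> real"

definition ser8 :: "ncser \<Rightarrow> (nat \<Rightarrow> alg) \<Rightarrow> alg" where
  "ser8 f r = (\<lambda>m. \<Sum>w\<in>{w. set w \<subseteq> {..<8} \<and> length w \<le> deg m}.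
                    f w * aprod_list (map r w) m)"

definition cpart :: "alg \<Rightarrow> bool \<Rightarrow> alg \<Rightarrow> alg" where
  "cpart Q i X = ascale (1/2)
     (if i then X \<ominus> (ainv Q \<otimes> X \<otimes> Q) else X \<oplus> (ainv Q \<otimes> X \<otimes> Q))"

text \<open>Split variable r_(k+1), k = 4(j-1) + 2 iota1 + iota2, relative to base (Q1,Q2).\<close>
definition split_var :: "alg \<Rightarrow> alg \<Rightarrow> alg \<Rightarrow> alg \<Rightarrow> nat \<Rightarrow> alg" where
  "split_var Q1 Q2 A1 A2 k =
     (let j0 = (k div 4 = 0); i1 = ((k mod 4) div 2 = 1); i2 = (k mod 2 = 1);
          Qj = (if j0 then Q1 else Q2); Aj = (if j0 then A1 else A2);
          X = (Aj \<ominus> Qj) \<otimes> ainv Qj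
      in cpart Q2 i2 (cpart Q1 i1 X))"

definition sc_op :: "ncser \<Rightarrow> alg \<Rightarrow> alg \<Rightarrow> alg \<Rightarrow> alg \<Rightarrow> alg" where
  "sc_op f Q1 Q2 A1 A2 = ser8 f (split_var Q1 Q2 A1 A2)"

definition ps_op :: "ncser \<Rightarrow> alg \<Rightarrow> alg \<Rightarrow> alg \<Rightarrow> alg \<Rightarrow> alg" where
  "ps_op f Q1 Q2 A1 A2 = ser8 f (split_var Q1 Q2 A1 A2) \<otimes> (Q1 \<otimes> Q2)"

text \<open>Generic arguments A_i = Q_i + R_i with R_1 = var 0, R_2 = var 1 free infinitesimals;
theta_1 = 1 + var 2, theta_2 = 1 + var 3 with fresh free infinitesimals.\<close>
definition gA1 :: alg where "gA1 = aQ1 \<oplus> var 0"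
definition gA2 :: alg where "gA2 = aQ2 \<oplus> var 1"
definition th1 :: alg where "th1 = aone \<oplus> var 2"
definition th2 :: alg where "th2 = aone \<oplus> var 3"

definition rot1 :: "alg \<Rightarrow> alg \<Rightarrow> alg" where "rot1 B1 B2 = B1 \<oplus> tt \<otimes> B2"
definition rot2 :: "alg \<Rightarrow> alg \<Rightarrow> alg" where "rot2 B1 B2 = B2 \<ominus> tt \<otimes> B1"

type_synonym fqop = "alg \<Rightarrow> alg \<Rightarrow> alg \<Rightarrow> alg \<Rightarrow> alg"

definition orth_invariant :: "fqop \<Rightarrow> bool" where
  "orth_invariant \<Xi> \<longleftrightarrow>
     \<Xi> aQ1 aQ2 gA1 gA2 = \<Xi> (rot1 aQ1 aQ2) (rot2 aQ1 aQ2) (rot1 gA1 gA2) (rot2 gA1 gA2)"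

definition left_variant :: "fqop \<Rightarrow> bool" where
  "left_variant \<Xi> \<longleftrightarrow>
     \<Xi> aQ1 aQ2 (th1 \<otimes> gA1 \<otimes> th2) (th1 \<otimes> gA2 \<otimes> th2) = th1 \<otimes> \<Xi> aQ1 aQ2 gA1 gA2 \<otimes> ainv th1"

definition right_variant :: "fqop \<Rightarrow> bool" where
  "right_variant \<Xi> \<longleftrightarrow>
     \<Xi> aQ1 aQ2 (th1 \<otimes> gA1 \<otimes> th2) (th1 \<otimes> gA2 \<otimes> th2) = ainv th2 \<otimes> \<Xi> aQ1 aQ2 gA1 gA2 \<otimes> th2"

text \<open>pol X = X (-X^2)^(-1/2), with (1+y)^(-1/2) the binomial series, y = -X^2 - 1.\<close>
definition pol :: "alg \<Rightarrow> alg" where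
  "pol X = X \<otimes> ser1 (\<lambda>n. (-1/2::real) gchoose n) (aneg (X \<otimes> X) \<ominus> aone)"

end

theory Submission
  imports Defs
begin

text \<open>A left-variant operation depends only on \<open>X = A1 A2\<^sup>-\<^sup>1\<close>, a right-variant one only on
\<open>X = A1\<^sup>-\<^sup>1 A2\<close>; in both cases \<open>X = J + v\<close> with \<open>J = - Q1 Q2\<close>, and the operation is a series
\<open>F\<close> in \<open>v\<close> with Clifford coefficients such that \<open>F (c X c\<^sup>-\<^sup>1) = c F (X) c\<^sup>-\<^sup>1\<close>. Put
\<open>c = 1 + t w\<close> with a fresh variable \<open>w\<close>. Freeness of the algebra allows one to compare the
monomials in which \<open>w\<close> comes first, and this forces \<open>F = a - b X + (1 + X\<^sup>2) G\<close> with real \<open>a, b\<close>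
and \<open>G\<close> again equivariant. Iterating, \<open>F = \<Sum>k. (1 + X\<^sup>2)\<^sup>k (a\<^sub>k - b\<^sub>k X)\<close>. Rotating the base is
conjugation by \<open>1 + (t/2) Q1 Q2\<close>, and rotating the arguments replaces \<open>X\<close> by
\<open>X \<plusminus> t (1 + X\<^sup>2)\<close>. Orthogonal invariance therefore becomes \<open>2 k a\<^sub>k = 0\<close> and
\<open>2 k b\<^sub>k = (2 k - 1) b\<^sub>k\<^sub>-\<^sub>1\<close>, the recursion of the binomial series of \<open>X (- X\<^sup>2)\<^sup>-\<^sup>1\<^sup>/\<^sup>2\<close>, so that
\<open>F = a\<^sub>0 - b\<^sub>0 pol X\<close>.\<close>

section \<open>The algebra as a real algebra with unit\<close>

text \<open>The factor \<open>t\<close> makes everything exact to first order: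
  \<open>1 + t w\<close> has the inverse \<open>1 - t w\<close>, and conjugation only adds
  \<open>t\<close> times a commutator, so each monomial of the comparison contains \<open>w\<close>
  at most once. A monomial in which \<open>w\<close> precedes every \<open>v\<close> can only come
  from replacing the leading variable of a word of \<open>F\<close>, from \<open>w F\<close>, or
  from the constant terms in \<open>F w\<close>. Hence the comparison involves only
  \<open>F\<close>, its constant Clifford coefficients and its left quotients by \<open>h v\<close>.
  Its components at \<open>1\<close> and \<open>Q1 Q2\<close> form a closed system of two equations;
  eliminating one quotient leaves a division by \<open>1 + X^2\<close>.

  The obstacle is that \<open>1 + X^2\<close> is infinitesimal, since \<open>J^2 = -1\<close>, and
  so cannot be inverted. It can still be cancelled: \<open>1 + X^2 = v X - Q1 Q2 v\<close>, and the
  left quotient by \<open>Q1 Q2 v\<close> recovers the cofactor up to sign. This one fact passes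
  equivariance on to \<open>G\<close> and makes the coefficients of the expansion unique, so that
  the effect of a rotation can be compared power by power.\<close>

abbreviation mm :: "mon \<Rightarrow> mon \<Rightarrow> mon" where
  "mm a b \<equiv> snd (mon_mul a b)"

abbreviation sg :: "mon \<Rightarrow> mon \<Rightarrow> real" where
  "sg a b \<equiv> fst (mon_mul a b)"

definition vars :: "mon \<Rightarrow> nat set" where
  "vars m = fst ` set (snd (snd m))"

lemma mon_mul_Nil:
  "mon_mul (t1, h, []) (t2, g, vs) =
     ((if t1 \<and> t2 then 0 else 1) * fst (bas_mul h g), (t1 \<or> t2, snd (bas_mul h g), vs))"
  by (simp add: mon_mul_def Let_def)

lemma mon_mul_snoc:
  "mon_mul (t1, h, ws @ [(k, h')]) (t2, g, vs) =
     ((if t1 \<and> t2 then 0 else 1) * fst (bas_mul h' g),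
      (t1 \<or> t2, h, ws @ (k, snd (bas_mul h' g)) # vs))"
  by (simp add: mon_mul_def Let_def)

lemma mon_mul_single:
  "mon_mul (t1, h, [(k, h')]) (t2, g, vs) =
     ((if t1 \<and> t2 then 0 else 1) * fst (bas_mul h' g),
      (t1 \<or> t2, h, (k, snd (bas_mul h' g)) # vs))"
  using mon_mul_snoc[of t1 h "[]"] by simp

lemma bas_mul_assoc:
  "snd (bas_mul (snd (bas_mul a b)) c) = snd (bas_mul a (snd (bas_mul b c)))"
  "fst (bas_mul a b) * fst (bas_mul (snd (bas_mul a b)) c) =
   fst (bas_mul b c) * fst (bas_mul a (snd (bas_mul b c)))"
  by (cases a; cases b; cases c; auto simp: bas_mul_def Let_def)+

text \<open>Multiplication merges the last Clifford letter of the left factor with the first one of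
  the right factor, so words are split at their end.\<close>

lemma mon_cases [case_names Nil snoc]:
  assumes "\<And>t h. m = (t, h, []) \<Longrightarrow> P"
    and "\<And>t h ws k h'. m = (t, h, ws @ [(k, h')]) \<Longrightarrow> P"
  shows P
proof -
  obtain t h ws where m: "m = (t, h, ws)" by (cases m) auto
  show P
  proof (cases ws rule: rev_cases)
    case Nil
    then show ?thesis using m assms(1) by auto
  next
    case (snoc us x)
    then show ?thesis using m assms(2) by (cases x) auto
  qed
qed

lemma mm_assoc: "mm (mm a b) c = mm a (mm b c)"
proof -
  obtain t g vs where c: "c = (t, g, vs)" by (cases c) auto
  show ?thesis
  proof (cases a rule: mon_cases; cases b rule: mon_cases)
    fix t1 h1 ws1 k1 h1' t2 h2 ws2 k2 h2'
    assume *: "a = (t1, h1, ws1 @ [(k1, h1')])" "b = (t2, h2, ws2 @ [(k2, h2')])"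
    have "ws1 @ (k1, h') # ws2 @ [(k2, h2')] = (ws1 @ (k1, h') # ws2) @ [(k2, h2')]" for h' by simp
    then show ?thesis unfolding * c by (simp only: mon_mul_snoc snd_conv) (simp add: mon_mul_snoc)
  qed (auto simp: c mon_mul_Nil mon_mul_snoc bas_mul_assoc)
qed

text \<open>The cocycle identity of the structure constants. They also take the value 0, when
  \<open>t\<close> occurs twice, so the identity covers \<open>t^2 = 0\<close> along with the
  Clifford signs.\<close>

lemma sg_assoc: "sg a b * sg (mm a b) c = sg b c * sg a (mm b c)"
proof -
  obtain t g vs where c: "c = (t, g, vs)" by (cases c) auto
  show ?thesis
  proof (cases a rule: mon_cases; cases b rule: mon_cases)
    fix t1 h1 ws1 k1 h1' t2 h2 ws2 k2 h2'
    assume *: "a = (t1, h1, ws1 @ [(k1, h1')])" "b = (t2, h2, ws2 @ [(k2, h2')])"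
    have "ws1 @ (k1, h') # ws2 @ [(k2, h2')] = (ws1 @ (k1, h') # ws2) @ [(k2, h2')]" for h' by simp
    then show ?thesis unfolding * c by (simp only: mon_mul_snoc snd_conv fst_conv) (auto simp: mon_mul_snoc)
  qed (auto simp: c mon_mul_Nil mon_mul_snoc bas_mul_assoc)
qed

lemma deg_mm [simp]: "deg (mm a b) = deg a + deg b"
  by (cases a rule: mon_cases; cases b) (auto simp: mon_mul_Nil mon_mul_snoc deg_def)

lemma vars_mm: "vars (mm a b) = vars a \<union> vars b"
  by (cases a rule: mon_cases; cases b) (auto simp: mon_mul_Nil mon_mul_snoc vars_def)

lemma finite_bounded_mons:
  assumes "finite K"
  shows "finite {m. vars m \<subseteq> K \<and> deg m \<le> n}"
proof (rule finite_subset)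
  show "{m. vars m \<subseteq> K \<and> deg m \<le> n}
    \<subseteq> UNIV \<times> UNIV \<times> {ws. set ws \<subseteq> K \<times> UNIV \<and> length ws \<le> n}"
    by (force simp: vars_def deg_def)
  show "finite ((UNIV::bool set) \<times> (UNIV::bas set) \<times>
    {ws. set ws \<subseteq> K \<times> (UNIV::bas set) \<and> length ws \<le> n})"
    using assms by (intro finite_cartesian_product finite_lists_length_le) auto
qed

text \<open>Factors of \<open>m\<close> are bounded both in degree and in the variables they
  contain. The degree alone would not suffice, as there are infinitely many variables.\<close>

lemma finite_mm_fibre: "finite {p. mm (fst p) (snd p) = m}"
proof (rule finite_subset)
  let ?W = "{w. vars w \<subseteq> vars m \<and> deg w \<le> deg m}"
  show "{p. mm (fst p) (snd p) = m} \<subseteq> ?W \<times> ?W"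
    by (auto simp: vars_mm)
  have "finite (vars m)" by (simp add: vars_def)
  then show "finite (?W \<times> ?W)" by (intro finite_cartesian_product finite_bounded_mons)
qed

lemma finite_mm_fibre_right: "finite {b. mm a b = m}"
proof -
  have "finite (Pair a -` {p. mm (fst p) (snd p) = m})"
    by (intro finite_vimageI finite_mm_fibre) (auto simp: inj_def)
  then show ?thesis by (simp add: vimage_def)
qed

lemma amul_amon_left: "(amon a \<otimes> y) m = (\<Sum>b | mm a b = m. sg a b * y b)"
proof -
  have "(amon a \<otimes> y) m = (\<Sum>p\<in>Pair a ` {b. mm a b = m}. sg (fst p) (snd p) * amon a (fst p) * y (snd p))"
    unfolding amul_def
    by (rule sum.mono_neutral_right) (auto simp: finite_mm_fibre amon_def)
  also have "\<dots> = (\<Sum>b | mm a b = m. sg a b * y b)"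
    by (subst sum.reindex) (auto simp: inj_on_def amon_def)
  finally show ?thesis .
qed

lemma amul_amon_right: "(x \<otimes> amon b) m = (\<Sum>a | mm a b = m. sg a b * x a)"
proof -
  have "(x \<otimes> amon b) m = (\<Sum>p\<in>(\<lambda>a. (a, b)) ` {a. mm a b = m}. sg (fst p) (snd p) * x (fst p) * amon b (snd p))"
    unfolding amul_def
    by (rule sum.mono_neutral_right) (auto simp: finite_mm_fibre amon_def)
  also have "\<dots> = (\<Sum>a | mm a b = m. sg a b * x a)"
    by (subst sum.reindex) (auto simp: inj_on_def amon_def)
  finally show ?thesis .
qed

lemma mon_mul_one_left: "mon_mul (False, (False, False), []) b = (1, b)"
  by (cases b) (auto simp: mon_mul_Nil bas_mul_def Let_def)

lemma mon_mul_one_right: "mon_mul a (False, (False, False), []) = (1, a)"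
  by (cases a rule: mon_cases) (auto simp: mon_mul_Nil mon_mul_snoc bas_mul_def Let_def)

lemma amul_aone_left: "aone \<otimes> x = x"
  by (rule ext) (simp add: aone_def amul_amon_left mon_mul_one_left)

lemma amul_aone_right: "x \<otimes> aone = x"
  by (rule ext) (simp add: aone_def amul_amon_right mon_mul_one_right)

lemma amul_assoc: "(x \<otimes> y) \<otimes> z = x \<otimes> (y \<otimes> z)"
proof
  fix m
  let ?P = "\<lambda>m. {p. mm (fst p) (snd p) = m}"
  have "((x \<otimes> y) \<otimes> z) m =
      (\<Sum>p\<in>?P m. \<Sum>q\<in>?P (fst p). sg (fst p) (snd p) * (sg (fst q) (snd q) * x (fst q) * y (snd q)) * z (snd p))"
    by (simp add: amul_def sum_distrib_left sum_distrib_right)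
  also have "\<dots> = (\<Sum>(p, q)\<in>(SIGMA p:?P m. ?P (fst p)).
      sg (fst p) (snd p) * (sg (fst q) (snd q) * x (fst q) * y (snd q)) * z (snd p))"
    by (rule sum.Sigma) (auto simp: finite_mm_fibre)
  also have "\<dots> = (\<Sum>(p, q)\<in>(SIGMA p:?P m. ?P (snd p)).
      sg (fst p) (snd p) * x (fst p) * (sg (fst q) (snd q) * y (fst q) * z (snd q)))"
  proof -
    have *: "sg (mm a b) c * (sg a b * x a * y b) * z c = sg a (mm b c) * x a * (sg b c * y b * z c)"
      for a b c
    proof -
      have "sg (mm a b) c * sg a b = sg a (mm b c) * sg b c"
        using sg_assoc[of a b c] by (simp add: mult.commute)
      then show ?thesis
        by (metis (no_types, opaque_lifting) mult.assoc mult.commute)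
    qed
    \<comment> \<open>A factorisation \<open>m = a b c\<close> is coded as
      \<open>((ab, c), (a, b))\<close> on the left and as \<open>((a, bc), (b, c))\<close> on the
      right.\<close>
    show ?thesis
      by (rule sum.reindex_bij_witness
        [where i = "\<lambda>(p, q). ((mm (fst p) (fst q), snd q), (fst p, fst q))"
           and j = "\<lambda>(p, q). ((fst q, mm (snd q) (snd p)), (snd q, snd p))"])
        (auto simp: mm_assoc *, (metis mm_assoc sg_assoc mult.commute)+)
  qed
  also have "\<dots> = (\<Sum>p\<in>?P m. \<Sum>q\<in>?P (snd p).
      sg (fst p) (snd p) * x (fst p) * (sg (fst q) (snd q) * y (fst q) * z (snd q)))"
    by (rule sum.Sigma[symmetric]) (auto simp: finite_mm_fibre)
  also have "\<dots> = (x \<otimes> (y \<otimes> z)) m"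
    by (simp add: amul_def sum_distrib_left sum_distrib_right)
  finally show "((x \<otimes> y) \<otimes> z) m = (x \<otimes> (y \<otimes> z)) m" .
qed

text \<open>A class instance for \<open>alg\<close> itself would concern function types in general.
  The copy can be made a \<open>real_algebra_1\<close>, which gives access to ring notation and
  simplification.\<close>

typedef qalg = "UNIV :: alg set"
  morphisms coef mk by simp

setup_lifting type_definition_qalg

instantiation qalg :: real_algebra_1
begin

lift_definition zero_qalg :: qalg is "\<lambda>_. 0" .
lift_definition one_qalg :: qalg is aone .
lift_definition plus_qalg :: "qalg \<Rightarrow> qalg \<Rightarrow> qalg" is aadd .
lift_definition minus_qalg :: "qalg \<Rightarrow> qalg \<Rightarrow> qalg" is asub .
lift_definition uminus_qalg :: "qalg \<Rightarrow> qalg" is aneg .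
lift_definition times_qalg :: "qalg \<Rightarrow> qalg \<Rightarrow> qalg" is amul .
lift_definition scaleR_qalg :: "real \<Rightarrow> qalg \<Rightarrow> qalg" is ascale .

instance
proof
  fix x y z :: qalg and a b :: real
  show "x * y * z = x * (y * z)"
    by transfer (rule amul_assoc)
  show "1 * x = x" by transfer (rule amul_aone_left)
  show "x * 1 = x" by transfer (rule amul_aone_right)
  show "(x + y) * z = x * z + y * z"
    by transfer (auto simp: amul_def aadd_def sum.distrib[symmetric] algebra_simps intro!: sum.cong)
  show "x * (y + z) = x * y + x * z"
    by transfer (auto simp: amul_def aadd_def sum.distrib[symmetric] algebra_simps intro!: sum.cong)
  show "a *\<^sub>R x * y = a *\<^sub>R (x * y)"
    by transfer (auto simp: amul_def ascale_def sum_distrib_left algebra_simps intro!: sum.cong)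
  show "x * a *\<^sub>R y = a *\<^sub>R (x * y)"
    by transfer (auto simp: amul_def ascale_def sum_distrib_left algebra_simps intro!: sum.cong)
  show "(0::qalg) \<noteq> 1"
    by transfer (auto simp: aone_def amon_def fun_eq_iff)
qed (transfer; auto simp: aadd_def asub_def aneg_def ascale_def algebra_simps)+

end

lemma coef_simps [simp]:
  "coef 0 m = 0"
  "coef (x + y) m = coef x m + coef y m"
  "coef (x - y) m = coef x m - coef y m"
  "coef (- x) m = - coef x m"
  "coef (a *\<^sub>R x) m = a * coef x m"
  by (transfer, simp add: aadd_def asub_def aneg_def ascale_def)+

lemma coef_sum: "coef (sum f A) m = (\<Sum>i\<in>A. coef (f i) m)"
  by (induction A rule: infinite_finite_induct) auto

lemma coef_mk [simp]: "coef (mk x) = x"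
  by (simp add: mk_inverse)

lemma qalg_eqI: "(\<And>m. coef x m = coef y m) \<Longrightarrow> x = y"
  by (metis coef_inject ext)

lemma mk_hom:
  "mk (x \<oplus> y) = mk x + mk y" "mk (x \<ominus> y) = mk x - mk y" "mk (aneg x) = - mk x"
  "mk (x \<otimes> y) = mk x * mk y" "mk (ascale a x) = a *\<^sub>R mk x" "mk aone = 1"
  by (simp_all add: plus_qalg.abs_eq minus_qalg.abs_eq uminus_qalg.abs_eq times_qalg.abs_eq
      scaleR_qalg.abs_eq one_qalg.abs_eq)

lemma coef_hom:
  "coef x \<oplus> coef y = coef (x + y)" "coef x \<ominus> coef y = coef (x - y)" "aneg (coef x) = coef (- x)"
  "coef x \<otimes> coef y = coef (x * y)" "ascale a (coef x) = coef (a *\<^sub>R x)" "aone = coef 1"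
  by (transfer, simp)+

section \<open>Filtration, inverses and substitution\<close>

lemma coef_times:
  "coef (x * y) m = (\<Sum>p | mm (fst p) (snd p) = m. sg (fst p) (snd p) * coef x (fst p) * coef y (snd p))"
  by transfer (simp add: amul_def)

text \<open>The degree filtration. Identities between infinite sums are proved modulo every order,
  and \<open>ord_ge_eqI\<close> says that this determines an element.\<close>

definition ord_ge :: "nat \<Rightarrow> qalg \<Rightarrow> bool" where
  "ord_ge n x \<longleftrightarrow> (\<forall>m. deg m < n \<longrightarrow> coef x m = 0)"

lemma ord_geD: "ord_ge n x \<Longrightarrow> deg m < n \<Longrightarrow> coef x m = 0"
  unfolding ord_ge_def by blast

lemma ord_ge_trivial [simp]: "ord_ge 0 x" "ord_ge n 0"
  by (simp_all add: ord_ge_def)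

lemma ord_ge_mono: "ord_ge n x \<Longrightarrow> k \<le> n \<Longrightarrow> ord_ge k x"
  by (simp add: ord_ge_def)

lemma ord_ge_add: "ord_ge n x \<Longrightarrow> ord_ge n y \<Longrightarrow> ord_ge n (x + y)"
  and ord_ge_diff: "ord_ge n x \<Longrightarrow> ord_ge n y \<Longrightarrow> ord_ge n (x - y)"
  and ord_ge_minus: "ord_ge n x \<Longrightarrow> ord_ge n (- x)"
  and ord_ge_scaleR: "ord_ge n x \<Longrightarrow> ord_ge n (a *\<^sub>R x)"
  by (simp_all add: ord_ge_def)

lemma ord_ge_sum: "(\<And>i. i \<in> A \<Longrightarrow> ord_ge n (f i)) \<Longrightarrow> ord_ge n (sum f A)"
  by (simp add: ord_ge_def coef_sum)

lemma ord_ge_mult: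
  assumes "ord_ge a x" "ord_ge b y"
  shows "ord_ge (a + b) (x * y)"
  unfolding ord_ge_def
proof (intro allI impI)
  fix m assume "deg m < a + b"
  then have "sg (fst p) (snd p) * coef x (fst p) * coef y (snd p) = 0" if "mm (fst p) (snd p) = m" for p
  proof -
    have "deg (fst p) < a \<or> deg (snd p) < b"
      using that \<open>deg m < a + b\<close> by (metis deg_mm add_mono not_le)
    then show ?thesis using assms by (auto dest: ord_geD)
  qed
  then show "coef (x * y) m = 0"
    unfolding coef_times by (intro sum.neutral) blast
qed

lemma ord_ge_mult_left: "ord_ge n y \<Longrightarrow> ord_ge n (x * y)"
  using ord_ge_mult[of 0 x n y] by simp

lemma ord_ge_mult_right: "ord_ge n x \<Longrightarrow> ord_ge n (x * y)"
  using ord_ge_mult[of n x 0 y] by simp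

lemma ord_ge_power: "ord_ge 1 x \<Longrightarrow> ord_ge n (x ^ n)"
proof (induction n)
  case (Suc n)
  then show ?case using ord_ge_mult[of 1 x n "x ^ n"] by simp
qed simp

lemma ord_ge_prod_list: "(\<And>x. x \<in> set xs \<Longrightarrow> ord_ge 1 x) \<Longrightarrow> ord_ge (length xs) (prod_list xs)"
proof (induction xs)
  case (Cons x xs)
  then show ?case using ord_ge_mult[of 1 x "length xs" "prod_list xs"] by simp
qed simp

lemma ord_ge_eqI:
  assumes "\<And>n. ord_ge n (x - y)"
  shows "x = y"
proof (rule qalg_eqI)
  fix m
  show "coef x m = coef y m"
    using ord_geD[OF assms[of "Suc (deg m)"], of m] by simp
qed

lemma ord_ge_trans: "ord_ge n (x - y) \<Longrightarrow> ord_ge n (y - z) \<Longrightarrow> ord_ge n (x - z)"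
  by (simp add: ord_ge_def)

lemma ord_ge_sym: "ord_ge n (x - y) \<Longrightarrow> ord_ge n (y - x)"
  by (simp add: ord_ge_def)

lemma ord_ge_mult_cong:
  assumes "ord_ge n (x - x')" "ord_ge n (y - y')"
  shows "ord_ge n (x * y - x' * y')"
proof -
  have "x * y - x' * y' = (x - x') * y + x' * (y - y')"
    by (simp add: algebra_simps)
  then show ?thesis
    using assms by (auto intro: ord_ge_add ord_ge_mult_left ord_ge_mult_right)
qed

text \<open>Meant for sequences whose \<open>k\<close>-th term has order at least \<open>k\<close>:
  then the terms beyond \<open>deg m\<close> have coefficient 0 at \<open>m\<close>, and the
  truncated sum is the full one.\<close>

definition fsum :: "(nat \<Rightarrow> qalg) \<Rightarrow> qalg" where
  "fsum a = mk (\<lambda>m. \<Sum>k\<le>deg m. coef (a k) m)"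

lemma fsum_approx:
  assumes "\<And>k. ord_ge k (a k)"
  shows "ord_ge n (fsum a - (\<Sum>k<n. a k))"
  unfolding ord_ge_def
proof (intro allI impI)
  fix m assume "deg m < n"
  then have "(\<Sum>k\<le>deg m. coef (a k) m) = (\<Sum>k<n. coef (a k) m)"
    by (intro sum.mono_neutral_left) (auto intro: ord_geD[OF assms])
  then show "coef (fsum a - (\<Sum>k<n. a k)) m = 0"
    by (simp add: fsum_def coef_sum)
qed

lemma fsum_unique:
  assumes "\<And>k. ord_ge k (a k)" "\<And>n. ord_ge n (x - (\<Sum>k<n. a k))"
  shows "x = fsum a"
  using assms by (intro ord_ge_eqI) (metis fsum_approx ord_ge_trans ord_ge_sym)

section \<open>Units and inverses\<close>

definition qunit :: "qalg \<Rightarrow> bool" where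
  "qunit x \<longleftrightarrow> (\<exists>y. x * y = 1 \<and> y * x = 1)"

definition qinv :: "qalg \<Rightarrow> qalg" where
  "qinv x = mk (ainv (coef x))"

lemma qinv_unique:
  assumes "x * y = 1" "y * x = 1"
  shows "qinv x = y"
proof -
  have "ainv (coef x) = coef y"
    unfolding ainv_def
  proof (rule the_equality)
    show "coef x \<otimes> coef y = aone \<and> coef y \<otimes> coef x = aone"
      using assms by (simp add: coef_hom)
  next
    fix z assume z: "coef x \<otimes> z = aone \<and> z \<otimes> coef x = aone"
    then have "x * mk z = 1" "mk z * x = 1"
      by (metis coef_inverse mk_hom(4,6))+
    then have "mk z = y" using assms by (metis mult.assoc mult_1_left mult_1_right)
    then show "z = coef y" by auto
  qed
  then show ?thesis by (simp add: qinv_def coef_inverse)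
qed

lemma qinv_inverse:
  assumes "qunit x"
  shows "x * qinv x = 1" "qinv x * x = 1"
  using assms qinv_unique unfolding qunit_def by metis+

lemma qunitI: "x * y = 1 \<Longrightarrow> y * x = 1 \<Longrightarrow> qunit x"
  by (auto simp: qunit_def)

lemma qunit_mult:
  assumes "qunit x" "qunit y"
  shows "qunit (x * y)"
proof (rule qunitI)
  show "x * y * (qinv y * qinv x) = 1" "qinv y * qinv x * (x * y) = 1"
    using assms by (metis qinv_inverse mult.assoc mult_1_right)+
qed

text \<open>The inverse is the geometric series: its partial sums invert \<open>1 - y\<close> up to
  \<open>y ^ n\<close>, which has order \<open>n\<close>.\<close>

lemma qunit_geometric:
  assumes "ord_ge 1 y"
  shows "qunit (1 - y)"
proof -
  have pow: "\<And>k. ord_ge k (y ^ k)" using assms by (rule ord_ge_power)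
  define g where "g = fsum (\<lambda>k. y ^ k)"
  have g: "ord_ge n (g - (\<Sum>k<n. y ^ k))" for n
    unfolding g_def by (rule fsum_approx[OF pow])
  have tel: "(1 - y) * (\<Sum>k<n. y ^ k) = 1 - y ^ n" "(\<Sum>k<n. y ^ k) * (1 - y) = 1 - y ^ n" for n
  proof -
    have "(1 - y) * y ^ n = y ^ n - y ^ Suc n" "y ^ n * (1 - y) = y ^ n - y ^ Suc n" for n
      by (simp_all add: left_diff_distrib right_diff_distrib power_commutes)
    then show "(1 - y) * (\<Sum>k<n. y ^ k) = 1 - y ^ n" "(\<Sum>k<n. y ^ k) * (1 - y) = 1 - y ^ n"
      by (induction n) (simp_all add: distrib_left distrib_right)
  qed
  show ?thesis
  proof (rule qunitI; rule ord_ge_eqI)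
    fix n
    have "(1 - y) * g - 1 = (1 - y) * (g - (\<Sum>k<n. y ^ k)) - y ^ n"
      using tel(1)[of n] by (simp add: right_diff_distrib)
    then show "ord_ge n ((1 - y) * g - 1)"
      by (simp only:) (intro ord_ge_diff ord_ge_mult_left g pow)
    have "g * (1 - y) - 1 = (g - (\<Sum>k<n. y ^ k)) * (1 - y) - y ^ n"
      using tel(2)[of n] by (simp add: left_diff_distrib[of g])
    then show "ord_ge n (g * (1 - y) - 1)"
      by (simp only:) (intro ord_ge_diff ord_ge_mult_right g pow)
  qed
qed

text \<open>Such an \<open>x\<close> is \<open>q\<close> times one plus an infinitesimal.\<close>

lemma qunit_near:
  assumes "qunit q" "ord_ge 1 (x - q)"
  shows "qunit x"
proof -
  have "ord_ge 1 (- (qinv q * (x - q)))"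
    using assms by (intro ord_ge_minus ord_ge_mult_left)
  then have "qunit (q * (1 - - (qinv q * (x - q))))"
    using assms by (intro qunit_mult qunit_geometric)
  moreover have "q * (1 - - (qinv q * (x - q))) = x"
    using qinv_inverse(1)[OF assms(1)] by (simp add: distrib_left mult.assoc[symmetric])
  ultimately show ?thesis by simp
qed

lemma qinv_near:
  assumes "qunit q" "ord_ge 1 (x - q)"
  shows "ord_ge 1 (qinv x - qinv q)"
proof -
  have "qinv x - qinv q = - (qinv x * (x - q) * qinv q)"
    using qinv_inverse[OF assms(1)] qinv_inverse[OF qunit_near[OF assms]]
    by (simp add: algebra_simps mult.assoc[symmetric])
  then show ?thesis
    using assms(2) by (simp only:) (intro ord_ge_minus ord_ge_mult_right ord_ge_mult_left)
qed

section \<open>Filtered homomorphisms\<close>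

definition qhom :: "(qalg \<Rightarrow> qalg) \<Rightarrow> bool" where
  "qhom \<psi> \<longleftrightarrow> (\<forall>x y. \<psi> (x + y) = \<psi> x + \<psi> y) \<and> (\<forall>x y. \<psi> (x * y) = \<psi> x * \<psi> y) \<and>
     (\<forall>a x. \<psi> (a *\<^sub>R x) = a *\<^sub>R \<psi> x) \<and> \<psi> 1 = 1 \<and> (\<forall>n x. ord_ge n x \<longrightarrow> ord_ge n (\<psi> x))"

lemma qhom_simps:
  assumes "qhom \<psi>"
  shows "\<psi> (x + y) = \<psi> x + \<psi> y" "\<psi> (x * y) = \<psi> x * \<psi> y" "\<psi> (a *\<^sub>R x) = a *\<^sub>R \<psi> x" "\<psi> 1 = 1"
    "\<psi> 0 = 0" "\<psi> (- x) = - \<psi> x" "\<psi> (x - y) = \<psi> x - \<psi> y" "\<psi> (x ^ n) = \<psi> x ^ n"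
    "\<psi> (sum f A) = (\<Sum>i\<in>A. \<psi> (f i))" "\<psi> (prod_list xs) = prod_list (map \<psi> xs)"
proof -
  show *: "\<psi> (x + y) = \<psi> x + \<psi> y" "\<psi> (x * y) = \<psi> x * \<psi> y" "\<psi> (a *\<^sub>R x) = a *\<^sub>R \<psi> x" "\<psi> 1 = 1"
    for x y a using assms by (auto simp: qhom_def)
  show z: "\<psi> 0 = 0" using *(3)[of 0 0] by simp
  show "\<psi> (- x) = - \<psi> x" using *(3)[of "-1" x] by simp
  show "\<psi> (x - y) = \<psi> x - \<psi> y" using *(1)[of "x - y" y] by simp
  show "\<psi> (x ^ n) = \<psi> x ^ n" by (induction n) (simp_all add: *)
  show "\<psi> (sum f A) = (\<Sum>i\<in>A. \<psi> (f i))"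
    by (induction A rule: infinite_finite_induct) (simp_all add: * z)
  show "\<psi> (prod_list xs) = prod_list (map \<psi> xs)" by (induction xs) (simp_all add: *)
qed

lemma qhom_ord: "qhom \<psi> \<Longrightarrow> ord_ge n x \<Longrightarrow> ord_ge n (\<psi> x)"
  by (simp add: qhom_def)

text \<open>The order clause of \<open>qhom\<close> acts as continuity: it carries the approximation
  by partial sums through the homomorphism.\<close>

lemma qhom_fsum:
  assumes "qhom \<psi>" "\<And>k. ord_ge k (a k)"
  shows "\<psi> (fsum a) = fsum (\<lambda>k. \<psi> (a k))"
proof (rule fsum_unique)
  show "ord_ge k (\<psi> (a k))" for k by (rule qhom_ord[OF assms])
  show "ord_ge n (\<psi> (fsum a) - (\<Sum>k<n. \<psi> (a k)))" for n
    using qhom_ord[OF assms(1) fsum_approx[of a n, OF assms(2)]] by (simp add: qhom_simps[OF assms(1)])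
qed

lemma qhom_qinv:
  assumes "qhom \<psi>" "qunit x"
  shows "\<psi> (qinv x) = qinv (\<psi> x)"
proof (rule qinv_unique[symmetric])
  show "\<psi> x * \<psi> (qinv x) = 1" "\<psi> (qinv x) * \<psi> x = 1"
    by (simp_all only: qinv_inverse[OF assms(2)] qhom_simps(4)[OF assms(1)] flip: qhom_simps(2)[OF assms(1)])
qed

lemma qhom_conj:
  assumes "c * d = 1" "d * c = 1"
  shows "qhom (\<lambda>x. c * x * d)"
  unfolding qhom_def
proof (intro conjI allI impI)
  fix x y
  have "c * x * d * (c * y * d) = c * x * (d * c) * y * d" by (simp add: mult.assoc)
  then show "c * (x * y) * d = c * x * d * (c * y * d)" by (simp add: assms) (simp add: mult.assoc)
qed (auto simp: assms distrib_left distrib_right intro: ord_ge_mult_left ord_ge_mult_right)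

section \<open>Monomials as elements of the algebra\<close>

abbreviation mn :: "mon \<Rightarrow> qalg" where
  "mn m \<equiv> mk (amon m)"

abbreviation bas :: "bas \<Rightarrow> qalg" where
  "bas h \<equiv> mn (False, h, [])"

abbreviation tq :: qalg where
  "tq \<equiv> mn (True, (False, False), [])"

abbreviation vq :: "nat \<Rightarrow> qalg" where
  "vq k \<equiv> mn (False, (False, False), [(k, (False, False))])"

lemma bas_one [simp]: "bas (False, False) = 1"
  using mk_hom(6) by (simp add: aone_def)

lemma coef_mn_left: "coef (mn a * y) m = (\<Sum>b | mm a b = m. sg a b * coef y b)"
  by (metis amul_amon_left coef_mk times_qalg.rep_eq)

lemma coef_mn_right: "coef (x * mn b) m = (\<Sum>a | mm a b = m. sg a b * coef x a)"
  by (metis amul_amon_right coef_mk times_qalg.rep_eq)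

lemma mn_mult: "mn a * mn b = sg a b *\<^sub>R mn (mm a b)"
proof (rule qalg_eqI)
  fix m
  have "coef (mn a * mn b) m = (\<Sum>b' | mm a b' = m. if b' = b then sg a b' else 0)"
    unfolding coef_mn_left by (rule sum.cong) (auto simp: amon_def)
  also have "\<dots> = coef (sg a b *\<^sub>R mn (mm a b)) m"
    by (auto simp: finite_mm_fibre_right amon_def)
  finally show "coef (mn a * mn b) m = coef (sg a b *\<^sub>R mn (mm a b)) m" .
qed

lemma bas_mult: "bas h * bas g = fst (bas_mul h g) *\<^sub>R bas (snd (bas_mul h g))"
  by (simp add: mn_mult mon_mul_Nil)

lemma coef_tq_left: "coef (tq * y) (t, g, ws) = (if t then coef y (False, g, ws) else 0)"
proof -
  have mm: "mon_mul (True, (False, False), []) b = (if fst b then 0 else 1, (True, snd b))" for b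
    by (cases b) (auto simp: mon_mul_Nil bas_mul_def Let_def)
  have "{b. mm (True, (False, False), []) b = (t, g, ws)}
      = (if t then {(False, g, ws), (True, g, ws)} else {})"
    by (auto simp: mm)
  then show ?thesis by (simp add: coef_mn_left mm)
qed

lemma coef_tq_right: "coef (y * tq) (t, g, ws) = (if t then coef y (False, g, ws) else 0)"
proof -
  have mm: "mon_mul b (True, (False, False), []) = (if fst b then 0 else 1, (True, snd b))" for b
    by (cases b rule: mon_cases) (auto simp: mon_mul_Nil mon_mul_snoc bas_mul_def Let_def)
  have "{b. mm b (True, (False, False), []) = (t, g, ws)}
      = (if t then {(False, g, ws), (True, g, ws)} else {})"
    by (auto simp: mm)
  then show ?thesis by (simp add: coef_mn_right mm)
qed

lemma tq_central: "x * tq = tq * x"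
proof (rule qalg_eqI)
  show "coef (x * tq) m = coef (tq * x) m" for m
    by (cases m) (simp add: coef_tq_left coef_tq_right)
qed

lemma tq_left_commute: "x * (tq * y) = tq * (x * y)"
  by (metis tq_central mult.assoc)

lemma tq_square [simp]: "tq * tq = 0" "tq * (tq * x) = 0"
proof -
  show "tq * tq = 0" by (simp add: mn_mult mon_mul_Nil)
  then show "tq * (tq * x) = 0" by (metis mult.assoc mult_zero_left)
qed

lemma coef_letter_left:
  "coef (mn (False, h, [(k, (False, False))]) * y) (t, g, ws) =
    (case ws of [] \<Rightarrow> 0 | (k', g') # ws' \<Rightarrow> if k' = k \<and> g = h then coef y (t, g', ws') else 0)"
proof -
  have mm: "mon_mul (False, h, [(k, (False, False))]) (t', g', ws') = (1, (t', h, (k, g') # ws'))"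
    for t' g' ws'
    by (auto simp: mon_mul_single bas_mul_def Let_def)
  have "{b. mm (False, h, [(k, (False, False))]) b = (t, g, ws)}
      = (case ws of [] \<Rightarrow> {} | (k', g') # ws' \<Rightarrow> if k' = k \<and> g = h then {(t, g', ws')} else {})"
    by (auto simp: mm split: list.splits if_splits)
  then show ?thesis by (auto simp: coef_mn_left mm split: list.splits)
qed

lemma mn_letter: "mn (False, h, [(k, (False, False))]) = bas h * vq k"
  by (simp add: mn_mult mon_mul_Nil) (simp add: bas_mul_def Let_def)

text \<open>Freeness in the form used below: left multiplication by a Clifford element and a
  variable merely prepends a letter, so the remaining factor can be read off from the
  product.\<close>

lemma coef_bas_vq_left:
  "coef (bas h * vq k * y) (t, g, ws) =
    (case ws of [] \<Rightarrow> 0 | (k', g') # ws' \<Rightarrow> if k' = k \<and> g = h then coef y (t, g', ws') else 0)"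
  using coef_letter_left[of h k y t g ws] by (simp only: mn_letter[symmetric])

lemma ord_ge_vq [simp]: "ord_ge (Suc 0) (vq k)"
  by (auto simp: ord_ge_def amon_def deg_def)

section \<open>Substitution for the free variables\<close>

definition mval :: "(nat \<Rightarrow> qalg) \<Rightarrow> mon \<Rightarrow> qalg" where
  "mval s m = (case m of (t, h, ws) \<Rightarrow>
     (if t then tq else 1) * bas h * prod_list (map (\<lambda>(k, g). s k * bas g) ws))"

lemma tq_flag_mult:
  "((if t1 then tq else 1) * x) * ((if t2 then tq else 1) * y) =
     (if t1 \<and> t2 then 0 else 1::real) *\<^sub>R ((if t1 \<or> t2 then tq else 1) * (x * y))"
  by (cases t1; cases t2) (simp_all add: mult.assoc tq_left_commute[of x y])

text \<open>The values \<open>s k\<close> are arbitrary because the variables satisfy no relation;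
  only the Clifford product where the two words meet, the centrality of \<open>tq\<close> and
  \<open>tq * tq = 0\<close> enter.\<close>

lemma mval_mult: "mval s a * mval s b = sg a b *\<^sub>R mval s (mm a b)"
proof -
  obtain t2 g vs where b: "b = (t2, g, vs)" by (cases b) auto
  let ?P = "\<lambda>ws. prod_list (map (\<lambda>(k, g). s k * bas g) ws)"
  show ?thesis
  proof (cases a rule: mon_cases)
    case (Nil t1 h)
    have "bas h * (bas g * ?P vs) = fst (bas_mul h g) *\<^sub>R (bas (snd (bas_mul h g)) * ?P vs)"
      by (simp only: mult.assoc[symmetric] bas_mult mult_scaleR_left)
    then show ?thesis
      unfolding Nil b mval_def mon_mul_Nil prod.case mult.assoc[of _ "bas _"] tq_flag_mult
      by simp
  next
    case (snoc t1 h ws k h')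
    have "bas h * ?P (ws @ [(k, h')]) * (bas g * ?P vs) =
        bas h * ?P ws * s k * (bas h' * bas g) * ?P vs"
      by (simp add: mult.assoc)
    also have "\<dots> = fst (bas_mul h' g) *\<^sub>R (bas h * ?P (ws @ (k, snd (bas_mul h' g)) # vs))"
      by (simp add: bas_mult) (simp add: mult.assoc)
    finally show ?thesis
      unfolding snoc b mval_def mon_mul_snoc prod.case mult.assoc[of _ "bas _"] tq_flag_mult
      by simp
  qed
qed

lemma mval_ord:
  assumes "\<And>k. ord_ge 1 (s k)"
  shows "ord_ge (deg m) (mval s m)"
proof -
  obtain t h ws where m: "m = (t, h, ws)" by (cases m) auto
  have "ord_ge (length (map (\<lambda>(k, g). s k * bas g) ws)) (prod_list (map (\<lambda>(k, g). s k * bas g) ws))"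
    using assms by (intro ord_ge_prod_list) (auto intro: ord_ge_mult_right)
  then show ?thesis
    by (simp add: m mval_def deg_def ord_ge_mult_left)
qed

text \<open>Substitution of \<^term>\<open>s k\<close> for the variable \<^term>\<open>k\<close>. Only finitely many
variables can be kept, since infinite sums of distinct variables are elements of the algebra;
four suffice here, and the remaining ones are sent to zero.\<close>

definition mons :: "nat \<Rightarrow> mon set" where
  "mons n = {m. vars m \<subseteq> {..<4} \<and> deg m = n}"

definition subst :: "(nat \<Rightarrow> qalg) \<Rightarrow> qalg \<Rightarrow> qalg" where
  "subst s x = fsum (\<lambda>n. \<Sum>w\<in>mons n. coef x w *\<^sub>R mval s w)"

lemma finite_mons [simp]: "finite (mons n)"
  by (rule finite_subset[OF _ finite_bounded_mons[of "{..<4}" n]]) (auto simp: mons_def)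

context
  fixes s :: "nat \<Rightarrow> qalg"
  assumes s: "\<And>k. ord_ge 1 (s k)"
begin

lemma subst_term_ord: "ord_ge n (\<Sum>w\<in>mons n. coef x w *\<^sub>R mval s w)"
proof (intro ord_ge_sum ord_ge_scaleR)
  show "w \<in> mons n \<Longrightarrow> ord_ge n (mval s w)" for w
    using mval_ord[OF s, of w] by (simp add: mons_def)
qed

lemma subst_approx:
  "ord_ge n (subst s x - (\<Sum>w | vars w \<subseteq> {..<4} \<and> deg w < n. coef x w *\<^sub>R mval s w))"
proof -
  have "(\<Sum>k<n. \<Sum>w\<in>mons k. coef x w *\<^sub>R mval s w) =
      (\<Sum>w\<in>(\<Union>k<n. mons k). coef x w *\<^sub>R mval s w)"
    by (rule sum.UNION_disjoint[symmetric]) (simp_all, auto simp: mons_def)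
  moreover have "(\<Union>k<n. mons k) = {w. vars w \<subseteq> {..<4} \<and> deg w < n}"
    by (auto simp: mons_def)
  ultimately show ?thesis
    unfolding subst_def using fsum_approx[of "\<lambda>n. \<Sum>w\<in>mons n. coef x w *\<^sub>R mval s w" n, OF subst_term_ord] by simp
qed

lemma subst_add: "subst s (x + y) = subst s x + subst s y"
  by (rule qalg_eqI) (simp add: subst_def fsum_def scaleR_add_left sum.distrib)

lemma subst_scaleR: "subst s (a *\<^sub>R x) = a *\<^sub>R subst s x"
proof -
  have *: "(\<Sum>w\<in>M. (a * coef x w) *\<^sub>R mval s w) = a *\<^sub>R (\<Sum>w\<in>M. coef x w *\<^sub>R mval s w)" for M
    by (simp add: scaleR_sum_right)
  show ?thesis
    by (rule qalg_eqI) (simp only: subst_def fsum_def * coef_mk coef_simps(5) sum_distrib_left)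
qed

lemma subst_ord:
  assumes "ord_ge n x"
  shows "ord_ge n (subst s x)"
proof -
  have "(\<Sum>w | vars w \<subseteq> {..<4} \<and> deg w < n. coef x w *\<^sub>R mval s w) = 0"
    using assms by (intro sum.neutral) (auto simp: ord_ge_def)
  then show ?thesis using subst_approx[of n x] by simp
qed

lemma subst_mn: "subst s (mn w) = (if vars w \<subseteq> {..<4} then mval s w else 0)"
proof (rule ord_ge_eqI)
  fix n
  let ?W = "{w. vars w \<subseteq> {..<4} \<and> deg w < n}"
  have fin: "finite ?W"
    by (rule finite_subset[OF _ finite_bounded_mons[of "{..<4}" n]]) auto
  have "(\<Sum>w'\<in>?W. coef (mn w) w' *\<^sub>R mval s w') = (\<Sum>w'\<in>?W. if w = w' then mval s w' else 0)"
    by (intro sum.cong) (auto simp: amon_def)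
  also have "\<dots> = (if w \<in> ?W then mval s w else 0)"
    using fin by simp
  finally have *: "ord_ge n (subst s (mn w) - (if w \<in> ?W then mval s w else 0))"
    using subst_approx[of n "mn w"] by simp
  show "ord_ge n (subst s (mn w) - (if vars w \<subseteq> {..<4} then mval s w else 0))"
  proof (cases "w \<in> ?W")
    case True
    then show ?thesis using * by simp
  next
    case False
    have "ord_ge n (mval s w)" if "deg w \<ge> n"
      using mval_ord[OF s, of w] that by (rule ord_ge_mono)
    then show ?thesis
      using * False by (cases "vars w \<subseteq> {..<4}") (simp_all add: ord_ge_diff not_less if_not_P[of "_ \<and> _"])
  qed
qed

lemma subst_mult: "subst s (x * y) = subst s x * subst s y"
proof (rule ord_ge_eqI)
  fix n
  define W where "W = {w. vars w \<subseteq> {..<4} \<and> deg w < n}"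
  have fin: "finite W"
    unfolding W_def by (rule finite_subset[OF _ finite_bounded_mons[of "{..<4}" n]]) auto
  define P where "P = (\<lambda>x. \<Sum>w\<in>W. coef x w *\<^sub>R mval s w)"
  have approx: "ord_ge n (subst s x - P x)" for x
    using subst_approx[of n x] by (simp add: P_def W_def)
  let ?f = "\<lambda>p. (sg (fst p) (snd p) * coef x (fst p) * coef y (snd p)) *\<^sub>R mval s (mm (fst p) (snd p))"
  let ?V = "{p. mm (fst p) (snd p) \<in> W}"
  have sub: "?V \<subseteq> W \<times> W" by (auto simp: W_def vars_mm)
  \<comment> \<open>Pairs are sorted by the degree of their product: those below \<open>n\<close>
    regroup to \<open>P (x * y)\<close>, and all others contribute terms of order at least
    \<open>n\<close>.\<close>
  have "P x * P y = (\<Sum>p\<in>W \<times> W. ?f p)"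
    by (simp add: P_def sum_product sum.cartesian_product mval_mult case_prod_unfold algebra_simps)
  also have "\<dots> = (\<Sum>p\<in>?V. ?f p) + (\<Sum>p\<in>W \<times> W - ?V. ?f p)"
    using sub fin by (subst sum.subset_diff[OF sub]) (auto simp: add.commute)
  also have "(\<Sum>p\<in>?V. ?f p) = (\<Sum>w\<in>W. \<Sum>p | p \<in> ?V \<and> mm (fst p) (snd p) = w. ?f p)"
    using sub fin by (intro sum.group[symmetric]) (auto intro: finite_subset)
  also have "\<dots> = P (x * y)"
    unfolding P_def coef_times scaleR_sum_left
  proof (rule sum.cong[OF refl])
    fix w assume w: "w \<in> W"
    have eq: "{p \<in> ?V. mm (fst p) (snd p) = w} = {p. mm (fst p) (snd p) = w}" using w by auto
    show "(\<Sum>p | p \<in> ?V \<and> mm (fst p) (snd p) = w. ?f p) =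
       (\<Sum>p | mm (fst p) (snd p) = w. (sg (fst p) (snd p) * coef x (fst p) * coef y (snd p)) *\<^sub>R mval s w)"
      unfolding eq by (rule sum.cong) auto
  qed
  finally have eq: "P x * P y - P (x * y) = (\<Sum>p\<in>W \<times> W - ?V. ?f p)" by simp
  have "ord_ge n (?f p)" if "p \<in> W \<times> W - ?V" for p
  proof -
    have "deg (mm (fst p) (snd p)) \<ge> n"
      using that by (auto simp: W_def vars_mm not_less)
    then show ?thesis using mval_ord[OF s] by (intro ord_ge_scaleR) (rule ord_ge_mono)
  qed
  then have "ord_ge n (P x * P y - P (x * y))" unfolding eq by (rule ord_ge_sum)
  from ord_ge_trans[OF approx ord_ge_sym[OF this]] ord_ge_mult_cong[OF approx approx]
  show "ord_ge n (subst s (x * y) - subst s x * subst s y)"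
    by (rule ord_ge_trans[OF _ ord_ge_sym])
qed

lemma subst_generators:
  "subst s (bas h) = bas h" "subst s tq = tq" "k < 4 \<Longrightarrow> subst s (vq k) = s k"
  by (simp_all add: subst_mn mval_def vars_def)

lemma qhom_subst: "qhom (subst s)"
  unfolding qhom_def using subst_generators(1)[of "(False, False)"]
  by (simp add: subst_add subst_mult subst_scaleR subst_ord)

end

section \<open>Operations and their naturality\<close>

abbreviation q1 :: qalg where "q1 \<equiv> bas (True, False)"
abbreviation q2 :: qalg where "q2 \<equiv> bas (False, True)"
abbreviation q12 :: qalg where "q12 \<equiv> bas (True, True)"

lemma q_mult [simp]:
  "q1 * q1 = - 1" "q2 * q2 = - 1" "q1 * q2 = q12" "q2 * q1 = - q12" "q12 * q12 = - 1"
  "q1 * q12 = - q2" "q12 * q1 = q2" "q2 * q12 = q1" "q12 * q2 = - q1"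
  by (simp_all add: bas_mult bas_mul_def Let_def)

lemma q_mult_assoc [simp]:
  "q1 * (q1 * x) = - x" "q2 * (q2 * x) = - x" "q1 * (q2 * x) = q12 * x" "q2 * (q1 * x) = - (q12 * x)"
  "q12 * (q12 * x) = - x" "q1 * (q12 * x) = - (q2 * x)" "q12 * (q1 * x) = q2 * x"
  "q2 * (q12 * x) = q1 * x" "q12 * (q2 * x) = - (q1 * x)"
  by (simp_all flip: mult.assoc)

lemma qunit_q [simp]: "qunit q1" "qunit q2"
  by (rule qunitI[of _ "- q1"]; simp) (rule qunitI[of _ "- q2"]; simp)

lemma qinv_q [simp]: "qinv q1 = - q1" "qinv q2 = - q2"
  by (rule qinv_unique; simp)+

lemma qunit_one [simp]: "qunit 1"
  by (rule qunitI[of _ 1]) simp_all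

lemma qinv_one [simp]: "qinv 1 = 1"
  by (rule qinv_unique) simp_all

lemma ainv_coef: "ainv (coef x) = coef (qinv x)"
  by (simp add: qinv_def)

definition qpart :: "qalg \<Rightarrow> bool \<Rightarrow> qalg \<Rightarrow> qalg" where
  "qpart Q i X = (1/2) *\<^sub>R (if i then X - qinv Q * X * Q else X + qinv Q * X * Q)"

definition svar :: "qalg \<Rightarrow> qalg \<Rightarrow> qalg \<Rightarrow> qalg \<Rightarrow> nat \<Rightarrow> qalg" where
  "svar Q1 Q2 A1 A2 k =
     (let i1 = ((k mod 4) div 2 = 1); i2 = (k mod 2 = 1);
          Qj = (if k div 4 = 0 then Q1 else Q2); Aj = (if k div 4 = 0 then A1 else A2)
      in qpart Q2 i2 (qpart Q1 i1 ((Aj - Qj) * qinv Qj)))"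

lemma cpart_coef: "cpart (coef Q) i (coef X) = coef (qpart Q i X)"
  by (simp add: cpart_def qpart_def coef_hom ainv_coef)

lemma split_var_coef: "split_var (coef Q1) (coef Q2) (coef A1) (coef A2) = (\<lambda>k. coef (svar Q1 Q2 A1 A2 k))"
  by (rule ext) (simp add: split_var_def svar_def Let_def coef_hom ainv_coef cpart_coef)

definition words :: "nat \<Rightarrow> nat list set" where
  "words n = {w. set w \<subseteq> {..<8} \<and> length w = n}"

lemma finite_words [simp]: "finite (words n)"
  unfolding words_def by (rule finite_lists_length_eq) simp

definition qser :: "ncser \<Rightarrow> (nat \<Rightarrow> qalg) \<Rightarrow> qalg" where
  "qser f r = fsum (\<lambda>n. \<Sum>w\<in>words n. f w *\<^sub>R prod_list (map r w))"

lemma aprod_list_coef: "aprod_list (map (\<lambda>k. coef (r k)) w) = coef (prod_list (map r w))"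
  by (induction w) (simp_all add: aprod_list_def coef_hom)

lemma ser8_coef: "ser8 f (\<lambda>k. coef (r k)) = coef (qser f r)"
proof
  fix m
  have "{w. set w \<subseteq> {..<8} \<and> length w \<le> deg m} = (\<Union>k\<le>deg m. words k)"
    by (auto simp: words_def)
  then have "ser8 f (\<lambda>k. coef (r k)) m =
      (\<Sum>w\<in>(\<Union>k\<le>deg m. words k). f w * coef (prod_list (map r w)) m)"
    by (simp add: ser8_def aprod_list_coef)
  also have "\<dots> = (\<Sum>k\<le>deg m. \<Sum>w\<in>words k. f w * coef (prod_list (map r w)) m)"
    by (rule sum.UNION_disjoint) (simp_all, auto simp: words_def)
  also have "\<dots> = coef (qser f r) m"
    by (simp add: qser_def fsum_def coef_sum)
  finally show "ser8 f (\<lambda>k. coef (r k)) m = coef (qser f r) m" .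
qed

text \<open>The flag \<^term>\<open>p\<close> distinguishes pseudoscalar from scalar operations.\<close>

definition qop :: "ncser \<Rightarrow> bool \<Rightarrow> qalg \<Rightarrow> qalg \<Rightarrow> qalg \<Rightarrow> qalg \<Rightarrow> qalg" where
  "qop f p Q1 Q2 A1 A2 = qser f (svar Q1 Q2 A1 A2) * (if p then Q1 * Q2 else 1)"

lemma sc_op_coef: "sc_op f (coef Q1) (coef Q2) (coef A1) (coef A2) = coef (qop f False Q1 Q2 A1 A2)"
  by (simp add: sc_op_def qop_def split_var_coef ser8_coef)

lemma ps_op_coef: "ps_op f (coef Q1) (coef Q2) (coef A1) (coef A2) = coef (qop f True Q1 Q2 A1 A2)"
  by (simp add: ps_op_def qop_def split_var_coef ser8_coef coef_hom)

lemma svar_ord: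
  assumes "ord_ge 1 (A1 - Q1)" "ord_ge 1 (A2 - Q2)"
  shows "ord_ge 1 (svar Q1 Q2 A1 A2 k)"
proof -
  have part: "ord_ge 1 X \<Longrightarrow> ord_ge 1 (qpart Q i X)" for Q i X
    by (auto simp: qpart_def intro!: ord_ge_scaleR ord_ge_add ord_ge_diff
        intro: ord_ge_mult_right ord_ge_mult_left)
  then show ?thesis
    unfolding svar_def Let_def using assms by (intro part ord_ge_mult_right) simp
qed

lemma qser_term_ord:
  assumes "\<And>k. ord_ge 1 (r k)"
  shows "ord_ge n (\<Sum>w\<in>words n. f w *\<^sub>R prod_list (map r w))"
proof (intro ord_ge_sum ord_ge_scaleR)
  fix w assume "w \<in> words n"
  then show "ord_ge n (prod_list (map r w))"
    using ord_ge_prod_list[of "map r w"] assms by (auto simp: words_def)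
qed

text \<open>An operation is built from ring operations, inverses and convergent series, all of which
  a filtered homomorphism respects. Applied to substitutions it specialises generic arguments,
  applied to conjugations it moves the base.\<close>

lemma qop_natural:
  assumes h: "qhom \<psi>" and u: "qunit Q1" "qunit Q2"
    and o: "ord_ge 1 (A1 - Q1)" "ord_ge 1 (A2 - Q2)"
  shows "\<psi> (qop f p Q1 Q2 A1 A2) = qop f p (\<psi> Q1) (\<psi> Q2) (\<psi> A1) (\<psi> A2)"
proof -
  have part: "\<psi> (qpart Q i X) = qpart (\<psi> Q) i (\<psi> X)" if "qunit Q" for Q i X
    using that by (simp add: qpart_def qhom_simps[OF h] qhom_qinv[OF h])
  have svar: "\<psi> (svar Q1 Q2 A1 A2 k) = svar (\<psi> Q1) (\<psi> Q2) (\<psi> A1) (\<psi> A2) k" for k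
    using u by (simp add: svar_def Let_def part qhom_simps[OF h] qhom_qinv[OF h])
  have "\<psi> (qser f (svar Q1 Q2 A1 A2)) = qser f (\<lambda>k. \<psi> (svar Q1 Q2 A1 A2 k))"
    unfolding qser_def
    by (subst qhom_fsum[OF h qser_term_ord[OF svar_ord[OF o]]])
      (simp add: qhom_simps[OF h] comp_def)
  then show ?thesis
    by (simp add: qop_def svar qhom_simps[OF h])
qed

section \<open>Invariance and variance at general arguments\<close>

definition op_orth_invariant :: "ncser \<Rightarrow> bool \<Rightarrow> bool" where
  "op_orth_invariant f p \<longleftrightarrow> (let g1 = q1 + vq 0; g2 = q2 + vq 1 in
     qop f p q1 q2 g1 g2 = qop f p (q1 + tq * q2) (q2 - tq * q1) (g1 + tq * g2) (g2 - tq * g1))"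

definition op_left_variant :: "ncser \<Rightarrow> bool \<Rightarrow> bool" where
  "op_left_variant f p \<longleftrightarrow> (let g1 = q1 + vq 0; g2 = q2 + vq 1; \<theta>1 = 1 + vq 2; \<theta>2 = 1 + vq 3 in
     qop f p q1 q2 (\<theta>1 * g1 * \<theta>2) (\<theta>1 * g2 * \<theta>2) = \<theta>1 * qop f p q1 q2 g1 g2 * qinv \<theta>1)"

definition op_right_variant :: "ncser \<Rightarrow> bool \<Rightarrow> bool" where
  "op_right_variant f p \<longleftrightarrow> (let g1 = q1 + vq 0; g2 = q2 + vq 1; \<theta>1 = 1 + vq 2; \<theta>2 = 1 + vq 3 in
     qop f p q1 q2 (\<theta>1 * g1 * \<theta>2) (\<theta>1 * g2 * \<theta>2) = qinv \<theta>2 * qop f p q1 q2 g1 g2 * \<theta>2)"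

lemma generators_coef:
  "aQ1 = coef q1" "aQ2 = coef q2" "tt = coef tq" "gA1 = coef (q1 + vq 0)" "gA2 = coef (q2 + vq 1)"
  "th1 = coef (1 + vq 2)" "th2 = coef (1 + vq 3)"
  by (simp_all add: aQ1_def aQ2_def tt_def gA1_def gA2_def th1_def th2_def var_def flip: coef_hom)

lemma orth_invariant_coef:
  "orth_invariant (sc_op f) \<longleftrightarrow> op_orth_invariant f False"
  "orth_invariant (ps_op f) \<longleftrightarrow> op_orth_invariant f True"
  by (simp_all add: orth_invariant_def op_orth_invariant_def rot1_def rot2_def generators_coef coef_hom
      sc_op_coef ps_op_coef coef_inject Let_def
      del: coef_mk)

lemma left_variant_coef:
  "left_variant (sc_op f) \<longleftrightarrow> op_left_variant f False"
  "left_variant (ps_op f) \<longleftrightarrow> op_left_variant f True"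
  by (simp_all add: left_variant_def op_left_variant_def generators_coef coef_hom ainv_coef
      sc_op_coef ps_op_coef coef_inject Let_def
      del: coef_mk)

lemma right_variant_coef:
  "right_variant (sc_op f) \<longleftrightarrow> op_right_variant f False"
  "right_variant (ps_op f) \<longleftrightarrow> op_right_variant f True"
  by (simp_all add: right_variant_def op_right_variant_def generators_coef coef_hom ainv_coef
      sc_op_coef ps_op_coef coef_inject Let_def
      del: coef_mk)

definition subst4 :: "qalg \<Rightarrow> qalg \<Rightarrow> qalg \<Rightarrow> qalg \<Rightarrow> qalg \<Rightarrow> qalg" where
  "subst4 a b c d = subst (\<lambda>k. if k = 0 then a else if k = 1 then b else if k = 2 then c
     else if k = 3 then d else 0)"

lemma subst4:
  assumes "ord_ge 1 a" "ord_ge 1 b" "ord_ge 1 c" "ord_ge 1 d"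
  shows "qhom (subst4 a b c d)" "subst4 a b c d (bas h) = bas h" "subst4 a b c d tq = tq"
    "subst4 a b c d (vq 0) = a" "subst4 a b c d (vq (Suc 0)) = b"
    "subst4 a b c d (vq 2) = c" "subst4 a b c d (vq 3) = d"
  unfolding subst4_def
proof -
  let ?s = "\<lambda>k. if k = 0 then a else if k = 1 then b else if k = 2 then c else if k = 3 then d else 0"
  have s: "ord_ge 1 (?s k)" for k using assms by auto
  show "qhom (subst ?s)" "subst ?s (bas h) = bas h" "subst ?s tq = tq"
    by (rule qhom_subst subst_generators, rule s)+
  show "subst ?s (vq 0) = a" "subst ?s (vq (Suc 0)) = b" "subst ?s (vq 2) = c" "subst ?s (vq 3) = d"
    using subst_generators(3)[of ?s, OF s] by simp_all
qed

lemma ord_ge_near_mult: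
  assumes "ord_ge n (x - 1)" "ord_ge n (y - q)" "ord_ge n (z - 1)"
  shows "ord_ge n (x * y * z - q)"
  using ord_ge_mult_cong[OF ord_ge_mult_cong[OF assms(1,2)] assms(3)] by simp

text \<open>The definition speaks of generic arguments. Substituting \<open>A1 - q1\<close>,
  \<open>A2 - q2\<close>, \<open>\<theta>1 - 1\<close>, \<open>\<theta>2 - 1\<close> for the four
  free variables carries it over by naturality.\<close>

lemma left_variance:
  assumes lv: "op_left_variant f p"
    and o: "ord_ge 1 (A1 - q1)" "ord_ge 1 (A2 - q2)" "ord_ge 1 (\<theta>1 - 1)" "ord_ge 1 (\<theta>2 - 1)"
  shows "qop f p q1 q2 (\<theta>1 * A1 * \<theta>2) (\<theta>1 * A2 * \<theta>2) = \<theta>1 * qop f p q1 q2 A1 A2 * qinv \<theta>1"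
proof -
  let ?\<psi> = "subst4 (A1 - q1) (A2 - q2) (\<theta>1 - 1) (\<theta>2 - 1)"
  note s = subst4[OF o]
  note hs = qhom_simps[OF s(1)]
  have unit: "qunit (1 + vq 2)" by (rule qunit_near[of 1]) simp_all
  have "?\<psi> (qop f p q1 q2 ((1 + vq 2) * (q1 + vq 0) * (1 + vq 3)) ((1 + vq 2) * (q2 + vq 1) * (1 + vq 3)))
      = ?\<psi> ((1 + vq 2) * qop f p q1 q2 (q1 + vq 0) (q2 + vq 1) * qinv (1 + vq 2))"
    using lv by (simp add: op_left_variant_def Let_def)
  then show ?thesis
    by (simp add: hs s qop_natural[OF s(1)] ord_ge_near_mult qhom_qinv[OF s(1) unit])
qed

lemma right_variance:
  assumes rv: "op_right_variant f p"
    and o: "ord_ge 1 (A1 - q1)" "ord_ge 1 (A2 - q2)" "ord_ge 1 (\<theta>1 - 1)" "ord_ge 1 (\<theta>2 - 1)"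
  shows "qop f p q1 q2 (\<theta>1 * A1 * \<theta>2) (\<theta>1 * A2 * \<theta>2) = qinv \<theta>2 * qop f p q1 q2 A1 A2 * \<theta>2"
proof -
  let ?\<psi> = "subst4 (A1 - q1) (A2 - q2) (\<theta>1 - 1) (\<theta>2 - 1)"
  note s = subst4[OF o]
  note hs = qhom_simps[OF s(1)]
  have unit: "qunit (1 + vq 3)" by (rule qunit_near[of 1]) simp_all
  have "?\<psi> (qop f p q1 q2 ((1 + vq 2) * (q1 + vq 0) * (1 + vq 3)) ((1 + vq 2) * (q2 + vq 1) * (1 + vq 3)))
      = ?\<psi> (qinv (1 + vq 3) * qop f p q1 q2 (q1 + vq 0) (q2 + vq 1) * (1 + vq 3))"
    using rv by (simp add: op_right_variant_def Let_def)
  then show ?thesis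
    by (simp add: hs s qop_natural[OF s(1)] ord_ge_near_mult qhom_qinv[OF s(1) unit])
qed

lemma tq_mult_tq: "tq * x * (tq * y) = 0"
  by (simp only: mult.assoc tq_left_commute[of x y] tq_square(2))

lemma tq_conj: "(1 + tq * v) * x * (1 - tq * v) = x + tq * (v * x - x * v)"
  using tq_mult_tq[of "v * x" v] tq_left_commute[of x v] by (simp add: algebra_simps)

lemma tq_conj_inverse: "(1 + tq * v) * (1 - tq * v) = 1" "(1 - tq * v) * (1 + tq * v) = 1"
  using tq_conj[of v 1] tq_conj[of "- v" 1] by simp_all

text \<open>Rotating the base by \<^term>\<open>tq\<close> is conjugation by \<^term>\<open>1 + tq * ((1/2) *\<^sub>R q12)\<close>, so orthogonal
invariance can be expressed with the base fixed.\<close>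

lemma orth_fixed_base:
  assumes oi: "op_orth_invariant f p"
  defines "g1 \<equiv> q1 + vq 0" and "g2 \<equiv> q2 + vq 1"
    and "c \<equiv> 1 + tq * ((1/2) *\<^sub>R q12)" and "d \<equiv> 1 - tq * ((1/2) *\<^sub>R q12)"
  shows "qop f p q1 q2 (d * (g1 + tq * g2) * c) (d * (g2 - tq * g1) * c) = d * qop f p q1 q2 g1 g2 * c"
    and "ord_ge 1 (d * (g1 + tq * g2) * c - q1)" and "ord_ge 1 (d * (g2 - tq * g1) * c - q2)"
proof -
  have cd: "c * d = 1" "d * c = 1"
    unfolding c_def d_def by (rule tq_conj_inverse)+
  have half: "(1/2) *\<^sub>R x + (1/2) *\<^sub>R x = x" "- ((1/2) *\<^sub>R x) - (1/2) *\<^sub>R x = - x" for x :: qalg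
    by (simp_all flip: scaleR_add_left scaleR_minus_left scaleR_diff_left)
  \<comment> \<open>The factor 1/2 compensates the commutators: \<open>q12 * q1 - q1 * q12\<close>
    is twice \<open>q2\<close>, and \<open>q12 * q2 - q2 * q12\<close> is minus twice
    \<open>q1\<close>.\<close>
  have rot: "c * q1 * d = q1 + tq * q2" "c * q2 * d = q2 - tq * q1"
    unfolding c_def d_def tq_conj by (simp_all add: half)
  have restore: "c * (d * x * c) * d = x" "d * (c * x * d) * c = x" for x
  proof -
    have "c * (d * x * c) * d = (c * d) * x * (c * d)" "d * (c * x * d) * c = (d * c) * x * (d * c)"
      by (simp_all only: mult.assoc)
    then show "c * (d * x * c) * d = x" "d * (c * x * d) * c = x" by (simp_all add: cd)
  qed
  have unrot: "d * (q1 + tq * q2) * c = q1" "d * (q2 - tq * q1) * c = q2"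
    unfolding rot[symmetric] by (rule restore)+
  let ?B1 = "d * (g1 + tq * g2) * c" and ?B2 = "d * (g2 - tq * g1) * c"
  have "?B1 - q1 = d * (vq 0 + tq * vq 1) * c" "?B2 - q2 = d * (vq 1 - tq * vq 0) * c"
    using unrot by (simp_all add: g1_def g2_def algebra_simps)
  then show near: "ord_ge 1 (?B1 - q1)" "ord_ge 1 (?B2 - q2)"
    by (simp_all add: ord_ge_mult_right ord_ge_mult_left ord_ge_add ord_ge_diff)
  have "c * qop f p q1 q2 ?B1 ?B2 * d = qop f p (c * q1 * d) (c * q2 * d) (c * ?B1 * d) (c * ?B2 * d)"
    by (rule qop_natural[OF qhom_conj[OF cd]]) (use near in simp_all)
  also have "\<dots> = qop f p q1 q2 g1 g2"
    unfolding restore rot using oi by (simp add: op_orth_invariant_def Let_def g1_def g2_def)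
  finally have "d * (c * qop f p q1 q2 ?B1 ?B2 * d) * c = d * qop f p q1 q2 g1 g2 * c"
    by (rule arg_cong)
  then show "qop f p q1 q2 ?B1 ?B2 = d * qop f p q1 q2 g1 g2 * c"
    unfolding restore .
qed

section \<open>Series in one variable\<close>

abbreviation v0 :: qalg where "v0 \<equiv> vq 0"
abbreviation v1 :: qalg where "v1 \<equiv> vq (Suc 0)"

text \<open>Series in the single variable \<open>v0\<close> with Clifford coefficients. Excluding
  \<open>t\<close> and \<open>v1\<close> ensures that in later comparisons these letters come from
  the conjugation only.\<close>

definition v0_series :: "qalg \<Rightarrow> bool" where
  "v0_series x \<longleftrightarrow> (\<forall>m. coef x m \<noteq> 0 \<longrightarrow> \<not> fst m \<and> vars m \<subseteq> {0})"

lemma v0_seriesD: "v0_series x \<Longrightarrow> fst m \<or> \<not> vars m \<subseteq> {0} \<Longrightarrow> coef x m = 0"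
  unfolding v0_series_def by blast

lemma v0_seriesI: "(\<And>m. fst m \<or> \<not> vars m \<subseteq> {0} \<Longrightarrow> coef x m = 0) \<Longrightarrow> v0_series x"
  unfolding v0_series_def by blast

lemma v0_series_linear:
  "v0_series 0"
  "v0_series x \<Longrightarrow> v0_series y \<Longrightarrow> v0_series (x + y)"
  "v0_series x \<Longrightarrow> v0_series y \<Longrightarrow> v0_series (x - y)"
  "v0_series x \<Longrightarrow> v0_series (- x)"
  "v0_series x \<Longrightarrow> v0_series (a *\<^sub>R x)"
  by (rule v0_seriesI; simp add: v0_seriesD)+

lemma v0_series_sum: "(\<And>i. i \<in> A \<Longrightarrow> v0_series (f i)) \<Longrightarrow> v0_series (sum f A)"
  by (induction A rule: infinite_finite_induct) (simp_all add: v0_series_linear)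

lemma fst_mm: "fst (mm a b) \<longleftrightarrow> fst a \<or> fst b"
  by (cases a rule: mon_cases; cases b) (auto simp: mon_mul_Nil mon_mul_snoc)

lemma v0_series_mult:
  assumes "v0_series x" "v0_series y"
  shows "v0_series (x * y)"
  unfolding v0_series_def
proof (intro allI impI)
  fix m assume "coef (x * y) m \<noteq> 0"
  then obtain p where "mm (fst p) (snd p) = m" "coef x (fst p) \<noteq> 0" "coef y (snd p) \<noteq> 0"
    unfolding coef_times by (auto elim!: sum.not_neutral_contains_not_neutral simp del: split_paired_Ex)
  then show "\<not> fst m \<and> vars m \<subseteq> {0}"
    using assms fst_mm vars_mm unfolding v0_series_def by blast
qed

lemma v0_series_generators: "v0_series (bas h)" "v0_series 1" "v0_series v0"
proof -
  show *: "v0_series (bas h)" for h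
    by (auto simp: v0_series_def amon_def vars_def)
  show "v0_series 1" using *[of "(False, False)"] by simp
  show "v0_series v0"
    by (auto simp: v0_series_def amon_def vars_def)
qed

lemma v0_series_prod_list: "(\<And>x. x \<in> set xs \<Longrightarrow> v0_series x) \<Longrightarrow> v0_series (prod_list xs)"
  by (induction xs) (simp_all add: v0_series_mult v0_series_generators)

lemma v0_series_power: "v0_series x \<Longrightarrow> v0_series (x ^ n)"
  by (induction n) (simp_all add: v0_series_mult v0_series_generators)

lemma v0_series_fsum:
  assumes "\<And>k. v0_series (a k)"
  shows "v0_series (fsum a)"
  unfolding v0_series_def
proof (intro allI impI)
  fix m assume "coef (fsum a) m \<noteq> 0"
  then obtain k where "coef (a k) m \<noteq> 0"
    by (auto simp: fsum_def elim: sum.not_neutral_contains_not_neutral)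
  then show "\<not> fst m \<and> vars m \<subseteq> {0}"
    using assms unfolding v0_series_def by blast
qed

lemmas v0_series_intros = v0_series_linear v0_series_mult v0_series_generators

lemma v0_series_qop:
  assumes "v0_series A1" "v0_series A2"
  shows "v0_series (qop f p q1 q2 A1 A2)"
proof -
  have part: "v0_series (qpart Q i X)" if "Q \<in> {q1, q2}" "v0_series X" for Q i X
    using that by (auto simp: qpart_def intro!: v0_series_intros)
  have "v0_series (svar q1 q2 A1 A2 k)" for k
    unfolding svar_def Let_def using assms
    by (intro part) (auto intro!: v0_series_intros)
  then show ?thesis
    unfolding qop_def qser_def
    by (auto intro!: v0_series_intros v0_series_fsum v0_series_sum v0_series_prod_list)
qed

lemma mval_vq: "mval vq w = mn w"
proof -
  obtain t h ws where w: "w = (t, h, ws)" by (cases w) auto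
  have "mval vq (t, h, ws) = mn (t, h, ws)"
  proof (induction ws rule: rev_induct)
    case Nil
    show ?case by (simp add: mval_def mn_mult mon_mul_Nil) (simp add: bas_mul_def Let_def)
  next
    case (snoc x ws)
    obtain k g where x: "x = (k, g)" by (cases x) auto
    have 1: "vq k * bas g = mn (False, (False, False), [(k, g)])"
      by (simp add: mn_mult mon_mul_single) (simp add: bas_mul_def Let_def)
    have 2: "mn (t, h, ws) * mn (False, (False, False), [(k, g)]) = mn (t, h, ws @ [(k, g)])"
    proof (cases ws rule: rev_cases)
      case Nil
      then show ?thesis by (simp add: mn_mult mon_mul_Nil) (simp add: bas_mul_def Let_def)
    next
      case (snoc us y)
      then show ?thesis
        by (cases y) (simp add: mn_mult mon_mul_snoc, simp add: bas_mul_def Let_def)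
    qed
    have "mval vq (t, h, ws @ [x]) = mval vq (t, h, ws) * (vq k * bas g)"
      by (simp add: mval_def x mult.assoc)
    then show ?case by (simp only: snoc.IH 1 2 x)
  qed
  then show ?thesis by (simp add: w)
qed

lemma tq_mval:
  assumes "\<And>k. k \<in> vars w \<Longrightarrow> tq * s k = tq * s' k"
  shows "tq * mval s w = tq * mval s' w"
proof -
  obtain t h ws where w: "w = (t, h, ws)" by (cases w) auto
  have "tq * prod_list (map (\<lambda>(k, g). s k * bas g) ws) = tq * prod_list (map (\<lambda>(k, g). s' k * bas g) ws)"
    using assms unfolding w vars_def
  proof (induction ws)
    case (Cons x ws)
    obtain k g where x: "x = (k, g)" by (cases x) auto
    let ?P = "\<lambda>s. prod_list (map (\<lambda>(k, g). s k * bas g) ws)"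
    have "tq * (s k * bas g * ?P s) = s k * bas g * (tq * ?P s)"
      by (simp only: tq_left_commute)
    also have "\<dots> = s k * bas g * (tq * ?P s')"
      using Cons by simp
    also have "\<dots> = (tq * s k) * bas g * ?P s'"
      by (simp only: tq_left_commute mult.assoc)
    also have "\<dots> = tq * (s' k * bas g * ?P s')"
      using Cons.prems x by (simp add: mult.assoc)
    finally show ?case by (simp add: x)
  qed simp
  then show ?thesis
    unfolding w mval_def prod.case
    by (cases t) (simp_all add: mult.assoc flip: tq_left_commute[of "bas h"])
qed

definition ev :: "qalg \<Rightarrow> qalg \<Rightarrow> qalg" where
  "ev z = subst4 z 0 0 0"

lemma ev:
  assumes "ord_ge 1 z"
  shows "qhom (ev z)" "ev z (bas h) = bas h" "ev z v0 = z"
  unfolding ev_def by (rule subst4; use assms in simp)+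

text \<open>The factor \<open>tq\<close> annihilates the difference of \<open>z\<close> and
  \<open>v0\<close>, hence every trace of it in the substituted series, and substituting
  \<open>v0\<close> for itself changes nothing.\<close>

lemma tq_ev:
  assumes F: "v0_series F" and z: "ord_ge 1 z" "tq * z = tq * v0"
  shows "tq * ev z F = tq * F"
proof (rule ord_ge_eqI)
  fix n
  let ?s = "\<lambda>k. if k = 0 then z else if k = 1 then 0 else if k = 2 then 0 else if k = 3 then 0 else 0::qalg"
  let ?W = "{w. vars w \<subseteq> {..<4} \<and> deg w < n}"
  have fin: "finite ?W"
    by (rule finite_subset[OF _ finite_bounded_mons[of "{..<4}" n]]) auto
  have "ord_ge n (ev z F - (\<Sum>w\<in>?W. coef F w *\<^sub>R mval ?s w))"
    unfolding ev_def subst4_def by (rule subst_approx) (use z in auto)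
  then have 1: "ord_ge n (tq * ev z F - tq * (\<Sum>w\<in>?W. coef F w *\<^sub>R mval ?s w))"
    by (simp add: ord_ge_mult_left flip: right_diff_distrib)
  have "tq * (\<Sum>w\<in>?W. coef F w *\<^sub>R mval ?s w) = (\<Sum>w\<in>?W. coef F w *\<^sub>R (tq * mval ?s w))"
    by (simp add: sum_distrib_left)
  also have "\<dots> = (\<Sum>w\<in>?W. coef F w *\<^sub>R (tq * mn w))"
  proof (rule sum.cong[OF refl])
    fix w
    show "coef F w *\<^sub>R (tq * mval ?s w) = coef F w *\<^sub>R (tq * mn w)"
    proof (cases "coef F w = 0")
      case False
      then have "vars w \<subseteq> {0}" using F unfolding v0_series_def by blast
      then have "tq * mval ?s w = tq * mval vq w"
        using z by (intro tq_mval) auto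
      then show ?thesis by (simp add: mval_vq)
    qed simp
  qed
  also have "\<dots> = tq * (\<Sum>w\<in>?W. coef F w *\<^sub>R mn w)"
    by (simp add: sum_distrib_left)
  finally have 2: "tq * (\<Sum>w\<in>?W. coef F w *\<^sub>R mval ?s w) = tq * (\<Sum>w\<in>?W. coef F w *\<^sub>R mn w)" .
  \<comment> \<open>The sum runs over words in four variables only, but loses nothing below degree
    \<open>n\<close>, because \<open>F\<close> contains no variable except
    \<open>v0\<close>.\<close>
  have "ord_ge n ((\<Sum>w\<in>?W. coef F w *\<^sub>R mn w) - F)"
    unfolding ord_ge_def
  proof (intro allI impI)
    fix m assume m: "deg m < n"
    have "coef (\<Sum>w\<in>?W. coef F w *\<^sub>R mn w) m = (\<Sum>w\<in>?W. if m = w then coef F w else 0)"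
      by (simp add: coef_sum amon_def if_distrib cong: if_cong)
    also have "\<dots> = (if m \<in> ?W then coef F m else 0)"
      using fin by simp
    also have "\<dots> = coef F m"
    proof (cases "coef F m = 0")
      case False
      then have "vars m \<subseteq> {0}" using F unfolding v0_series_def by blast
      then show ?thesis using m by auto
    qed simp
    finally show "coef ((\<Sum>w\<in>?W. coef F w *\<^sub>R mn w) - F) m = 0" by simp
  qed
  then have "ord_ge n (tq * (\<Sum>w\<in>?W. coef F w *\<^sub>R mn w) - tq * F)"
    by (simp add: ord_ge_mult_left flip: right_diff_distrib)
  with 1 show "ord_ge n (tq * ev z F - tq * F)"
    unfolding 2 by (rule ord_ge_trans)
qed

section \<open>Quotients by an initial letter\<close>

definition lquot :: "bas \<Rightarrow> qalg \<Rightarrow> qalg" where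
  "lquot h x = mk (\<lambda>(t, g, ws). coef x (t, h, (0, g) # ws))"

text \<open>Reads off what follows \<open>h v1\<close> in the part of first order in
  \<open>t\<close>. The flag is dropped, so that the result is again free of \<open>t\<close> and
  comparable with \<open>F\<close>.\<close>

definition tquot :: "bas \<Rightarrow> qalg \<Rightarrow> qalg" where
  "tquot h x = mk (\<lambda>(t, g, ws). if t then 0 else coef x (True, h, (Suc 0, g) # ws))"

lemma lquot_linear:
  "lquot h (x + y) = lquot h x + lquot h y" "lquot h (x - y) = lquot h x - lquot h y"
  "lquot h (- x) = - lquot h x"
  by (rule qalg_eqI; auto simp: lquot_def)+

lemma tquot_linear:
  "tquot h (x + y) = tquot h x + tquot h y" "tquot h (x - y) = tquot h x - tquot h y"
  "tquot h (a *\<^sub>R x) = a *\<^sub>R tquot h x" "tquot h 0 = 0"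
  by (rule qalg_eqI; auto simp: tquot_def)+

lemma tquot_sum: "tquot h (sum f A) = (\<Sum>i\<in>A. tquot h (f i))"
  by (induction A rule: infinite_finite_induct) (simp_all add: tquot_linear)

lemma lquot_letter: "lquot h (bas h' * v0 * y) = (if h = h' then y else 0)"
  by (rule qalg_eqI) (auto simp: lquot_def coef_bas_vq_left)

lemma tquot_v0_series:
  assumes "v0_series x"
  shows "tquot h x = 0"
proof (rule qalg_eqI)
  show "coef (tquot h x) m = coef 0 m" for m
    using v0_seriesD[OF assms, of "(True, _)"] by (cases m) (simp add: tquot_def)
qed

lemma tquot_v0: "tquot h (bas h' * v0 * y) = 0" "tquot h (tq * (bas h' * v0 * y)) = 0"
  by (rule qalg_eqI; auto simp: tquot_def coef_tq_left coef_bas_vq_left)+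

lemma tquot_v1:
  assumes "v0_series y"
  shows "tquot h (tq * (bas h' * v1 * y)) = (if h = h' then y else 0)"
proof (rule qalg_eqI)
  fix m :: mon
  obtain t g ws where m: "m = (t, g, ws)" by (cases m) auto
  have "coef y (True, g, ws) = 0" using v0_seriesD[OF assms] by simp
  then show "coef (tquot h (tq * (bas h' * v1 * y))) m = coef (if h = h' then y else 0) m"
    by (auto simp: m tquot_def coef_tq_left coef_bas_vq_left)
qed

lemma v0_series_lquot:
  assumes "v0_series x"
  shows "v0_series (lquot h x)"
  unfolding v0_series_def
proof (intro allI impI)
  fix m assume "coef (lquot h x) m \<noteq> 0"
  then have "coef x (fst m, h, (0, fst (snd m)) # snd (snd m)) \<noteq> 0"
    by (simp add: lquot_def case_prod_unfold)
  then have "\<not> fst (fst m, h, (0, fst (snd m)) # snd (snd m))"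
    "vars (fst m, h, (0, fst (snd m)) # snd (snd m)) \<subseteq> {0}"
    using assms unfolding v0_series_def by blast+
  then show "\<not> fst m \<and> vars m \<subseteq> {0}"
    by (auto simp: vars_def)
qed

lemma v0_series_decomp:
  assumes "v0_series F"
  shows "F = (\<Sum>h\<in>UNIV. coef F (False, h, []) *\<^sub>R bas h) + (\<Sum>h\<in>UNIV. bas h * v0 * lquot h F)"
proof (rule qalg_eqI)
  fix m :: mon
  obtain t g ws where m: "m = (t, g, ws)" by (cases m) auto
  have z: "coef F m' = 0" if "fst m' \<or> \<not> vars m' \<subseteq> {0}" for m'
    using assms that unfolding v0_series_def by blast
  show "coef F m = coef ((\<Sum>h\<in>UNIV. coef F (False, h, []) *\<^sub>R bas h) + (\<Sum>h\<in>UNIV. bas h * v0 * lquot h F)) m"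
  proof (cases ws)
    case Nil
    have "(\<Sum>h\<in>UNIV. coef F (False, h, []) * amon (False, h, []) (t, g, [])) =
        (\<Sum>h\<in>UNIV. if g = h then (if t then 0 else coef F (False, h, [])) else 0)"
      by (rule sum.cong) (auto simp: amon_def)
    then show ?thesis
      using z[of m] by (cases t) (simp_all add: m Nil coef_sum coef_bas_vq_left)
  next
    case (Cons x ws')
    obtain k g' where x: "x = (k, g')" by (cases x) auto
    have "(\<Sum>h\<in>UNIV. coef (bas h * v0 * lquot h F) m) =
        (\<Sum>h\<in>UNIV. if g = h then (if k = 0 then coef F (t, h, (0, g') # ws') else 0) else 0)"
      by (rule sum.cong) (auto simp: m Cons x coef_bas_vq_left lquot_def)
    moreover have "(\<Sum>h\<in>UNIV. coef F (False, h, []) * amon (False, h, []) m) = 0"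
      by (simp add: m Cons amon_def)
    ultimately show ?thesis
      using z[of m] by (simp add: m Cons x coef_sum vars_def)
  qed
qed

section \<open>Equivariant series\<close>

abbreviation xq :: qalg where "xq \<equiv> v0 - q12"

text \<open>The element substituted for \<open>v0\<close> is chosen so that \<open>xq\<close>
  becomes its conjugate by \<open>1 + tq * v1\<close>. Since the substitution fixes
  \<open>q12\<close>, the commutator has to be taken with \<open>xq\<close> and not with
  \<open>v0\<close>.\<close>

definition equivariant :: "qalg \<Rightarrow> bool" where
  "equivariant F \<longleftrightarrow> v0_series F \<and>
     ev (v0 + tq * (v1 * xq - xq * v1)) F = (1 + tq * v1) * F * (1 - tq * v1)"

lemma ord_conj_letter: "ord_ge 1 (v0 + tq * (v1 * xq - xq * v1))"
  by (simp add: ord_ge_add ord_ge_diff ord_ge_mult_left ord_ge_mult_right)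

lemma v0_series_xq: "v0_series xq"
  by (intro v0_series_intros)

lemma square_xq_mult: "(1 + xq * xq) * y = bas (False, False) * v0 * (xq * y) - q12 * v0 * y"
  by (simp add: algebra_simps)

text \<open>As \<open>q12\<close> squares to -1, the constant terms of \<open>1 + xq * xq\<close>
  cancel and exactly one of the two remaining words begins with \<open>q12 * v0\<close>. The
  infinitesimal \<open>1 + xq * xq\<close> can therefore be cancelled on the left.\<close>

lemma lquot_square: "lquot (True, True) ((1 + xq * xq) * y) = - y"
  unfolding square_xq_mult lquot_linear lquot_letter by simp

lemma sum_bas: "(\<Sum>h\<in>UNIV. \<phi> h) = \<phi> (False, False) + \<phi> (True, False) + \<phi> (False, True) + \<phi> (True, True)"
  for \<phi> :: "bas \<Rightarrow> 'a::comm_monoid_add"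
  by (simp add: UNIV_Times_UNIV[symmetric] UNIV_bool sum.cartesian_product[symmetric] ac_simps
      del: UNIV_Times_UNIV)

text \<open>Comparing, in the equivariance equation, the monomials \<open>t h v1 \<dots>\<close> in which no \<open>v0\<close>
precedes \<open>v1\<close> expresses \<^term>\<open>F\<close> through its left quotients.\<close>

lemma equivariant_quotients:
  assumes "equivariant F"
  shows "xq * lquot (False, False) F - lquot (True, True) F = F - coef F (False, (False, False), []) *\<^sub>R 1"
    and "xq * lquot (True, True) F + lquot (False, False) F = - coef F (False, (True, True), []) *\<^sub>R 1"
proof -
  let ?W = "v1 * xq - xq * v1"
  let ?z = "v0 + tq * ?W"
  let ?f = "\<lambda>h. coef F (False, h, [])"
  let ?K = "\<lambda>h. lquot h F"
  let ?s = "\<lambda>h. fst (bas_mul h (True, True))"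
  let ?h = "\<lambda>h. snd (bas_mul h (True, True))"
  have F: "v0_series F" and eq: "ev ?z F = (1 + tq * v1) * F * (1 - tq * v1)"
    using assms by (auto simp: equivariant_def)
  note e = ev[OF ord_conj_letter]
  have tz: "tq * ?z = tq * v0" by (simp add: distrib_left)
  have K: "v0_series (?K h)" for h by (rule v0_series_lquot[OF F])
  have tK: "tq * ev ?z (?K h) = tq * ?K h" for h
    by (rule tq_ev[OF K ord_conj_letter tz])
  \<comment> \<open>The first summand still begins with \<open>v0\<close>, whatever happens inside
    the quotient; only the correction of the leading letter can put \<open>v1\<close> in front, and
    there \<open>tq\<close> undoes the substitution in the quotient.\<close>
  have word: "bas h * ?z * ev ?z (?K h) = bas h * v0 * ev ?z (?K h)
      + (tq * (bas h * v1 * (xq * ?K h)) - tq * (bas h * v0 * (v1 * ?K h)) + ?s h *\<^sub>R (tq * (bas (?h h) * v1 * ?K h)))" for h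
  proof -
    have "bas h * ?z * ev ?z (?K h) = bas h * v0 * ev ?z (?K h) + bas h * ?W * (tq * ev ?z (?K h))"
      by (simp only: distrib_left distrib_right tq_left_commute mult.assoc)
    also have "bas h * ?W * (tq * ev ?z (?K h)) = tq * (bas h * ?W * ?K h)"
      by (simp only: tK tq_left_commute)
    also have "bas h * ?W * ?K h = bas h * v1 * (xq * ?K h) - bas h * v0 * (v1 * ?K h) + (bas h * q12) * v1 * ?K h"
      by (simp only: left_diff_distrib right_diff_distrib mult.assoc) simp
    also have "bas h * q12 = ?s h *\<^sub>R bas (?h h)"
      by (rule bas_mult)
    finally show ?thesis
      by (simp add: distrib_left right_diff_distrib)
  qed
  have "ev ?z F = ev ?z ((\<Sum>h\<in>UNIV. ?f h *\<^sub>R bas h) + (\<Sum>h\<in>UNIV. bas h * v0 * ?K h))"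
    by (rule arg_cong[OF v0_series_decomp[OF F]])
  also have "\<dots> = (\<Sum>h\<in>UNIV. ?f h *\<^sub>R bas h) + (\<Sum>h\<in>UNIV. bas h * ?z * ev ?z (?K h))"
    by (simp only: qhom_simps[OF e(1)] e(2,3))
  finally have lhs: "ev ?z F = (\<Sum>h\<in>UNIV. ?f h *\<^sub>R bas h) + (\<Sum>h\<in>UNIV. bas h * ?z * ev ?z (?K h))" .
  have "F * v1 = (\<Sum>h\<in>UNIV. ?f h *\<^sub>R bas h) * v1 + (\<Sum>h\<in>UNIV. bas h * v0 * ?K h) * v1"
    by (rule trans[OF arg_cong[OF v0_series_decomp[OF F], of "\<lambda>x. x * v1"]]) (rule distrib_right)
  also have "\<dots> = (\<Sum>h\<in>UNIV. ?f h *\<^sub>R (bas h * v1 * 1)) + (\<Sum>h\<in>UNIV. bas h * v0 * (?K h * v1))"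
    by (simp add: sum_distrib_right mult.assoc)
  finally have Fv: "F * v1 = \<dots>" .
  have rhs: "ev ?z F = F + (tq * (bas (False, False) * v1 * F)
      - ((\<Sum>h\<in>UNIV. ?f h *\<^sub>R (tq * (bas h * v1 * 1))) + (\<Sum>h\<in>UNIV. tq * (bas h * v0 * (?K h * v1)))))"
  proof -
    have "ev ?z F = F + (tq * (v1 * F) - tq * (F * v1))"
      using eq[unfolded tq_conj] by (simp only: right_diff_distrib[of tq "v1 * F" "F * v1"])
    then show ?thesis
      unfolding Fv by (simp add: distrib_left sum_distrib_left)
  qed
  \<comment> \<open>One equation for each Clifford basis element \<open>g\<close>. Right
    multiplication by \<open>q12\<close> exchanges \<open>1\<close> and \<open>q12\<close> up to
    sign, so the equations for these two involve only the quotients at these two.\<close>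
  have key: "(\<Sum>h\<in>UNIV. (if g = h then xq * ?K h else 0) + ?s h *\<^sub>R (if g = ?h h then ?K h else 0))
      = (if g = (False, False) then F else 0) - (\<Sum>h\<in>UNIV. ?f h *\<^sub>R (if g = h then 1 else 0))" for g
  proof -
    have "tquot g (\<Sum>h\<in>UNIV. ?f h *\<^sub>R bas h) = 0"
      by (intro tquot_v0_series v0_series_sum v0_series_intros)
    then have "tquot g (ev ?z F)
        = (\<Sum>h\<in>UNIV. (if g = h then xq * ?K h else 0) + ?s h *\<^sub>R (if g = ?h h then ?K h else 0))"
      unfolding lhs word tquot_linear tquot_sum
      by (simp only: tquot_v0 tquot_v1[OF K] tquot_v1[OF v0_series_mult[OF v0_series_xq K]]) simp
    moreover have "tquot g (ev ?z F)
        = (if g = (False, False) then F else 0) - (\<Sum>h\<in>UNIV. ?f h *\<^sub>R (if g = h then 1 else 0))"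
      unfolding rhs tquot_linear tquot_sum
      by (simp only: tquot_v0 tquot_v1[OF F] tquot_v1[OF v0_series_generators(2)] tquot_v0_series[OF F]) simp
    ultimately show ?thesis by simp
  qed
  show "xq * ?K (False, False) - ?K (True, True) = F - ?f (False, False) *\<^sub>R 1"
    using key[of "(False, False)"] unfolding sum_bas by (simp add: bas_mul_def Let_def)
  show "xq * ?K (True, True) + ?K (False, False) = - ?f (True, True) *\<^sub>R 1"
    using key[of "(True, True)"] unfolding sum_bas by (simp add: bas_mul_def Let_def add.commute)
qed

text \<open>Eliminating the quotient at \<open>1\<close> between the two relations of
  \<open>equivariant_quotients\<close> gives a division by \<open>1 + xq * xq\<close> whose
  remainder is linear in \<open>xq\<close> with real coefficients.\<close>

lemma equivariant_division:
  assumes "equivariant F"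
  shows "F = coef F (False, (False, False), []) *\<^sub>R 1 - coef F (False, (True, True), []) *\<^sub>R xq
     + (1 + xq * xq) * (- lquot (True, True) F)"
proof -
  let ?K = "lquot (False, False) F" and ?L = "lquot (True, True) F"
  let ?a = "coef F (False, (False, False), [])" and ?b = "coef F (False, (True, True), [])"
  have K: "?K = - ?b *\<^sub>R 1 - xq * ?L"
    using equivariant_quotients(2)[OF assms] by (simp only: algebra_simps)
  have "F = ?a *\<^sub>R 1 + xq * ?K - ?L"
    using equivariant_quotients(1)[OF assms] by (simp only: algebra_simps)
  also have "xq * ?K = - (?b *\<^sub>R xq) - xq * xq * ?L"
    unfolding K by (simp only: right_diff_distrib[of xq "- ?b *\<^sub>R 1"] mult.assoc) simp
  also have "?a *\<^sub>R 1 + (- (?b *\<^sub>R xq) - xq * xq * ?L) - ?L = ?a *\<^sub>R 1 - ?b *\<^sub>R xq + (1 + xq * xq) * (- ?L)"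
    by (simp add: distrib_right)
  finally show ?thesis .
qed

text \<open>The linear remainder and the divisor are equivariant, so the defect of the quotient is
  annihilated by the conjugated divisor. Its outer unit factors are stripped off, and
  \<open>lquot_square\<close> cancels \<open>1 + xq * xq\<close> itself.\<close>

lemma equivariant_lquot:
  assumes "equivariant F"
  shows "equivariant (- lquot (True, True) F)"
proof -
  let ?z = "v0 + tq * (v1 * xq - xq * v1)" and ?c = "1 + tq * v1" and ?d = "1 - tq * v1"
  let ?G = "- lquot (True, True) F" and ?u = "1 + xq * xq"
  let ?a = "coef F (False, (False, False), [])" and ?b = "coef F (False, (True, True), [])"
  note e = ev[OF ord_conj_letter]
  note hs = qhom_simps[OF e(1)]
  define \<gamma> where "\<gamma> x = ?c * x * ?d" for x
  have "qhom \<gamma>"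
    unfolding \<gamma>_def by (rule qhom_conj) (rule tq_conj_inverse)+
  note gs = qhom_simps[OF \<open>qhom \<gamma>\<close>]
  have F: "F = ?a *\<^sub>R 1 - ?b *\<^sub>R xq + ?u * ?G" by (rule equivariant_division[OF assms])
  have x: "ev ?z xq = \<gamma> xq"
    unfolding \<gamma>_def tq_conj by (simp only: hs e) simp
  then have u: "ev ?z ?u = \<gamma> ?u"
    by (simp only: hs gs)
  have "ev ?z F = \<gamma> F" using assms by (simp add: equivariant_def \<gamma>_def)
  then have "ev ?z (?a *\<^sub>R 1 - ?b *\<^sub>R xq + ?u * ?G) = \<gamma> (?a *\<^sub>R 1 - ?b *\<^sub>R xq + ?u * ?G)"
    using F by simp
  then have "\<gamma> ?u * ev ?z ?G = \<gamma> ?u * \<gamma> ?G"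
    using x u by (simp only: hs(1-4,7) gs(1-4,7)) simp
  then have "\<gamma> ?u * (ev ?z ?G - \<gamma> ?G) = 0"
    by (simp only: right_diff_distrib[of "\<gamma> ?u"] diff_self)
  moreover have "\<gamma> ?u * w = ?c * (?u * (?d * w))" for w
    by (simp only: \<gamma>_def mult.assoc)
  ultimately have "?c * (?u * (?d * (ev ?z ?G - \<gamma> ?G))) = 0"
    by simp
  then have "?d * (?c * (?u * (?d * (ev ?z ?G - \<gamma> ?G)))) = 0"
    by (simp only: mult_zero_right)
  then have "?u * (?d * (ev ?z ?G - \<gamma> ?G)) = 0"
    by (simp only: mult.assoc[symmetric, of ?d ?c] tq_conj_inverse mult_1_left)
  then have "?d * (ev ?z ?G - \<gamma> ?G) = 0"
    using lquot_square[of "?d * (ev ?z ?G - \<gamma> ?G)"] by (simp add: lquot_def zero_qalg_def[symmetric] case_prod_unfold)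
  then have "?c * (?d * (ev ?z ?G - \<gamma> ?G)) = 0"
    by (simp only: mult_zero_right)
  then have "ev ?z ?G = \<gamma> ?G"
    by (simp only: mult.assoc[symmetric, of ?c ?d] tq_conj_inverse mult_1_left) simp
  moreover have "v0_series ?G"
    using assms by (intro v0_series_linear v0_series_lquot) (simp add: equivariant_def)
  ultimately show ?thesis
    by (simp add: equivariant_def \<gamma>_def)
qed

section \<open>Expansion in powers of 1 + X^2\<close>

definition quot_iter :: "qalg \<Rightarrow> nat \<Rightarrow> qalg" where
  "quot_iter F n = ((\<lambda>G. - lquot (True, True) G) ^^ n) F"

definition even_coef :: "qalg \<Rightarrow> nat \<Rightarrow> real" where
  "even_coef F n = coef (quot_iter F n) (False, (False, False), [])"

text \<open>The constant term of \<open>xq\<close> is \<open>- q12\<close>, so this number is the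
  coefficient of \<open>- xq\<close> in the remainder; hence the minus sign in the
  expansion.\<close>

definition odd_coef :: "qalg \<Rightarrow> nat \<Rightarrow> real" where
  "odd_coef F n = coef (quot_iter F n) (False, (True, True), [])"

lemma equivariant_quot_iter: "equivariant F \<Longrightarrow> equivariant (quot_iter F n)"
  by (induction n) (simp_all add: quot_iter_def equivariant_lquot)

lemma equivariant_expand:
  assumes "equivariant F"
  shows "F = (\<Sum>k<n. (1 + xq * xq) ^ k * (even_coef F k *\<^sub>R 1 - odd_coef F k *\<^sub>R xq))
     + (1 + xq * xq) ^ n * quot_iter F n"
proof (induction n)
  case 0
  show ?case by (simp add: quot_iter_def)
next
  case (Suc n)
  have "quot_iter F n = even_coef F n *\<^sub>R 1 - odd_coef F n *\<^sub>R xq + (1 + xq * xq) * quot_iter F (Suc n)"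
    using equivariant_division[OF equivariant_quot_iter[OF assms, of n]]
    by (simp add: even_coef_def odd_coef_def quot_iter_def)
  from arg_cong[OF this, of "\<lambda>y. (1 + xq * xq) ^ n * y"]
  have "(1 + xq * xq) ^ n * quot_iter F n =
      (1 + xq * xq) ^ n * (even_coef F n *\<^sub>R 1 - odd_coef F n *\<^sub>R xq)
      + (1 + xq * xq) ^ Suc n * quot_iter F (Suc n)"
    by (simp only: distrib_left[of _ "_ - _"] power_Suc2 mult.assoc)
  with Suc show ?case by (simp add: add.assoc)
qed

definition xser :: "(nat \<Rightarrow> real) \<Rightarrow> (nat \<Rightarrow> real) \<Rightarrow> qalg \<Rightarrow> qalg" where
  "xser a b X = fsum (\<lambda>k. (1 + X * X) ^ k * (a k *\<^sub>R 1 - b k *\<^sub>R X))"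

text \<open>\<open>X\<close> is close to \<open>- q12\<close>, a square root of -1. The
  factorisation used does not require \<open>X\<close> to commute with \<open>q12\<close>.\<close>

lemma ord_square:
  assumes "ord_ge 1 (X + q12)"
  shows "ord_ge 1 (1 + X * X)"
proof -
  have "1 + X * X = (X + q12) * X - q12 * (X + q12)"
    by (simp add: algebra_simps)
  then show ?thesis
    using assms by (simp only:) (intro ord_ge_diff ord_ge_mult_left[of _ _ q12] ord_ge_mult_right[of _ "X + q12"])
qed

lemma xser_term_ord:
  assumes "ord_ge 1 (X + q12)"
  shows "ord_ge k ((1 + X * X) ^ k * (a k *\<^sub>R 1 - b k *\<^sub>R X))"
  by (intro ord_ge_mult_right ord_ge_power ord_square assms)

text \<open>After \<open>n\<close> divisions the rest carries the factor
  \<open>(1 + X * X) ^ n\<close>, which has order \<open>n\<close>, so the finite expansions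
  converge.\<close>

lemma ev_equivariant:
  assumes "equivariant F" "ord_ge 1 (X + q12)"
  shows "ev (X + q12) F = xser (even_coef F) (odd_coef F) X"
  unfolding xser_def
proof (rule fsum_unique[OF xser_term_ord[OF assms(2)]])
  fix n
  note e = ev[OF assms(2)]
  have x: "ev (X + q12) xq = X" by (simp only: qhom_simps[OF e(1)] e(2,3)) simp
  have "ev (X + q12) F = (\<Sum>k<n. (1 + X * X) ^ k * (even_coef F k *\<^sub>R 1 - odd_coef F k *\<^sub>R X))
     + (1 + X * X) ^ n * ev (X + q12) (quot_iter F n)"
    by (subst equivariant_expand[OF assms(1), of n])
      (simp only: qhom_simps(1-4,8,9)[OF e(1)] qhom_simps(7)[OF e(1), of "_ *\<^sub>R 1"] x)
  then show "ord_ge n (ev (X + q12) F - (\<Sum>k<n. (1 + X * X) ^ k * (even_coef F k *\<^sub>R 1 - odd_coef F k *\<^sub>R X)))"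
    using ord_ge_mult_right[OF ord_ge_power[OF ord_square[OF assms(2)]]] by simp
qed

lemma xser_hom:
  assumes "qhom \<psi>" "ord_ge 1 (X + q12)"
  shows "\<psi> (xser a b X) = xser a b (\<psi> X)"
  unfolding xser_def
  by (subst qhom_fsum[OF assms(1) xser_term_ord[OF assms(2)]]) (simp add: qhom_simps[OF assms(1)])

section \<open>Rotating the argument\<close>

lemma lquot_ord:
  assumes "ord_ge (Suc n) x"
  shows "ord_ge n (lquot h x)"
  unfolding ord_ge_def
proof (intro allI impI)
  fix m assume "deg m < n"
  then have "deg (fst m, h, (0, fst (snd m)) # snd (snd m)) < Suc n" by (simp add: deg_def)
  from ord_geD[OF assms this] show "coef (lquot h x) m = 0"
    by (simp add: lquot_def case_prod_unfold)
qed

lemma coef_one: "coef 1 m = (if m = (False, (False, False), []) then 1 else 0)"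
  by (simp add: one_qalg.rep_eq aone_def amon_def)

lemma ord_square_xq: "ord_ge 1 (1 + xq * xq)"
  by (rule ord_square) simp

text \<open>The constant terms at \<open>1\<close> and \<open>q12\<close> determine
  \<open>p 0\<close> and \<open>q 0\<close>; once these vanish, \<open>lquot_square\<close> divides
  the sum by \<open>1 + xq * xq\<close> at the cost of one order.\<close>

lemma xq_powers_independent:
  assumes "ord_ge n (\<Sum>k<n. (1 + xq * xq) ^ k * (p k *\<^sub>R 1 + q k *\<^sub>R xq))" "k < n"
  shows "p k = 0 \<and> q k = 0"
  using assms
proof (induction n arbitrary: p q k)
  case (Suc n)
  let ?u = "1 + xq * xq"
  define S where "S = (\<Sum>k<n. ?u ^ k * (p (Suc k) *\<^sub>R 1 + q (Suc k) *\<^sub>R xq))"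
  have "(\<Sum>k<Suc n. ?u ^ k * (p k *\<^sub>R 1 + q k *\<^sub>R xq)) = p 0 *\<^sub>R 1 + q 0 *\<^sub>R xq + ?u * S"
    by (simp only: sum.lessThan_Suc_shift S_def sum_distrib_left power_Suc power_0 mult_1_left mult.assoc)
  with Suc.prems have o: "ord_ge (Suc n) (p 0 *\<^sub>R 1 + q 0 *\<^sub>R xq + ?u * S)" by simp
  have uS: "coef (?u * S) (False, h, []) = 0" for h
    using ord_geD[OF ord_ge_mult_right[OF ord_square_xq]] by (simp add: deg_def)
  have "p 0 = 0"
    using ord_geD[OF o, of "(False, (False, False), [])"] uS by (simp add: deg_def coef_one amon_def)
  moreover have "q 0 = 0"
    using ord_geD[OF o, of "(False, (True, True), [])"] uS by (simp add: deg_def coef_one amon_def)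
  ultimately have "ord_ge (Suc n) (?u * S)" using o by simp
  then have "ord_ge n (- S)"
    using lquot_ord[of n "?u * S" "(True, True)"] by (simp only: lquot_square)
  then have "ord_ge n S" using ord_ge_minus by fastforce
  then have IH: "p (Suc k) = 0 \<and> q (Suc k) = 0" if "k < n" for k
    unfolding S_def using Suc.IH[of "\<lambda>k. p (Suc k)" "\<lambda>k. q (Suc k)" k] that by blast
  show ?case
    using IH \<open>p 0 = 0\<close> \<open>q 0 = 0\<close> Suc.prems(2) by (cases k) auto
qed simp

lemma ord_ge_tq_cancel:
  assumes "v0_series x" "ord_ge n (tq * x)"
  shows "ord_ge n x"
  unfolding ord_ge_def
proof (intro allI impI)
  fix m assume m: "deg m < n"
  have "coef (tq * x) (True, snd m) = 0"
    using ord_geD[OF assms(2)] m by (simp add: deg_def)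
  then show "coef x m = 0"
    using v0_seriesD[OF assms(1), of m] coef_tq_left[of x True "fst (snd m)" "snd (snd m)"]
    by (cases "fst m") (simp_all, metis prod.collapse)
qed

text \<open>To first order in \<open>t\<close> the shift is the derivation \<open>D\<close> with
  \<open>D X = 1 + X * X\<close>. With \<open>u = 1 + X * X\<close>, which commutes with
  \<open>X\<close>, one has \<open>D (u^k) = 2 k u^k X\<close> and
  \<open>D (u^k X) = (2 k + 1) u^(k+1) - 2 k u^k\<close>. The recursion is the vanishing of the
  coefficients of \<open>u^k X\<close> and \<open>u^k\<close> in the derived series.\<close>

lemma xser_shift_coefs:
  assumes X: "ord_ge 1 (X + q12)" and Y: "Y = X + \<sigma> *\<^sub>R (tq * (1 + X * X))" and \<sigma>: "\<sigma> \<noteq> 0"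
    and eq: "xser a b X = xser a b Y"
    and \<chi>: "qhom \<chi>" "\<chi> tq = tq" "\<chi> X = xq"
  shows "a (Suc k) = 0" and "2 * real (Suc k) * b (Suc k) = (2 * real k + 1) * b k"
proof -
  define u where "u = 1 + X * X"
  have XX: "X * X = u - 1" by (simp add: u_def)
  have "X * u = u * X" by (simp add: u_def algebra_simps)
  have U: "1 + Y * Y = u + (2 * \<sigma>) *\<^sub>R (tq * (u * X))"
  proof -
    have "Y * Y = X * X + \<sigma> *\<^sub>R (X * (tq * u)) + \<sigma> *\<^sub>R (tq * u * X)"
      unfolding Y u_def[symmetric] by (simp add: distrib_left distrib_right tq_mult_tq)
    also have "X * (tq * u) = tq * (u * X)"
      using \<open>X * u = u * X\<close> by (simp only: tq_left_commute)
    finally have YY: "Y * Y = u - 1 + (\<sigma> *\<^sub>R (tq * (u * X)) + \<sigma> *\<^sub>R (tq * (u * X)))"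
      by (simp only: XX mult.assoc add.assoc)
    show ?thesis
      unfolding YY by (simp flip: scaleR_add_left)
  qed
  have Upow: "(1 + Y * Y) ^ k = u ^ k + (2 * real k * \<sigma>) *\<^sub>R (tq * (u ^ k * X))" for k
  proof (induction k)
    case (Suc k)
    have 1: "u ^ k * (tq * (u * X)) = tq * (u ^ Suc k * X)"
      by (simp only: tq_left_commute power_Suc2 mult.assoc)
    have 2: "tq * (u ^ k * X) * u = tq * (u ^ Suc k * X)"
      by (simp only: \<open>X * u = u * X\<close> power_Suc2 mult.assoc)
    have "(1 + Y * Y) ^ Suc k =
        (u ^ k + (2 * real k * \<sigma>) *\<^sub>R (tq * (u ^ k * X))) * (u + (2 * \<sigma>) *\<^sub>R (tq * (u * X)))"
      by (subst power_Suc2, subst Suc.IH, subst U) (rule refl)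
    also have "\<dots> = u ^ Suc k + (2 * \<sigma>) *\<^sub>R (tq * (u ^ Suc k * X)) + (2 * real k * \<sigma>) *\<^sub>R (tq * (u ^ Suc k * X))"
      by (simp only: distrib_left distrib_right mult_scaleR_left mult_scaleR_right 1 2 tq_mult_tq power_Suc2)
         simp
    also have "\<dots> = u ^ Suc k + (2 * real (Suc k) * \<sigma>) *\<^sub>R (tq * (u ^ Suc k * X))"
      by (simp only: add.assoc flip: scaleR_add_left) (simp add: algebra_simps)
    finally show ?case .
  qed simp
  \<comment> \<open>The contribution of the preceding term to the coefficient of
    \<open>u ^ k\<close>; there is none at \<open>k = 0\<close>.\<close>
  define \<beta> where "\<beta> k = (if k = 0 then 0 else (2 * real k - 1) * b (k - 1))" for k
  define p where "p k = 2 * real k * b k - \<beta> k" for k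
  define q where "q k = 2 * real k * a k" for k
  define T where "T k = u ^ k * ((2 * real k * b k) *\<^sub>R 1 + q k *\<^sub>R X) - \<beta> (Suc k) *\<^sub>R u ^ Suc k" for k
  have summand: "(1 + Y * Y) ^ k * (a k *\<^sub>R 1 - b k *\<^sub>R Y) =
      (1 + X * X) ^ k * (a k *\<^sub>R 1 - b k *\<^sub>R X) + \<sigma> *\<^sub>R (tq * T k)" for k
  proof -
    have uXX: "u ^ k * X * X = u ^ Suc k - u ^ k"
      by (simp add: mult.assoc XX right_diff_distrib power_Suc2 del: power_Suc)
    have "(1 + Y * Y) ^ k * (a k *\<^sub>R 1 - b k *\<^sub>R Y) =
        (u ^ k + (2 * real k * \<sigma>) *\<^sub>R (tq * (u ^ k * X)))
          * (a k *\<^sub>R 1 - b k *\<^sub>R X - (b k * \<sigma>) *\<^sub>R (tq * u))"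
      unfolding Upow by (simp add: Y u_def scaleR_add_right diff_diff_eq)
    also have "\<dots> = u ^ k * (a k *\<^sub>R 1 - b k *\<^sub>R X) - (b k * \<sigma>) *\<^sub>R (u ^ k * (tq * u))
        + (2 * real k * \<sigma>) *\<^sub>R (a k *\<^sub>R (tq * (u ^ k * X)) - b k *\<^sub>R (tq * (u ^ k * X * X)))"
    proof -
      have "(P + \<kappa> *\<^sub>R V) * (W - \<epsilon> *\<^sub>R Z) = P * W - \<epsilon> *\<^sub>R (P * Z) + \<kappa> *\<^sub>R (V * W)"
        if "V * Z = 0" for P V W Z :: qalg and \<kappa> \<epsilon> :: real
        using that by (simp add: distrib_right right_diff_distrib)
      from this[OF tq_mult_tq[of "u ^ k * X" u]]
      have "(u ^ k + (2 * real k * \<sigma>) *\<^sub>R (tq * (u ^ k * X))) * (a k *\<^sub>R 1 - b k *\<^sub>R X - (b k * \<sigma>) *\<^sub>R (tq * u))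
        = u ^ k * (a k *\<^sub>R 1 - b k *\<^sub>R X) - (b k * \<sigma>) *\<^sub>R (u ^ k * (tq * u))
          + (2 * real k * \<sigma>) *\<^sub>R (tq * (u ^ k * X) * (a k *\<^sub>R 1 - b k *\<^sub>R X))" .
      moreover have "tq * (u ^ k * X) * (a k *\<^sub>R 1 - b k *\<^sub>R X)
        = a k *\<^sub>R (tq * (u ^ k * X)) - b k *\<^sub>R (tq * (u ^ k * X * X))"
        by (simp add: right_diff_distrib mult.assoc)
      ultimately show ?thesis by (simp only:)
    qed
    also have "u ^ k * (tq * u) = tq * u ^ Suc k"
      by (simp only: tq_left_commute power_Suc2)
    also have "u ^ k * (a k *\<^sub>R 1 - b k *\<^sub>R X) - (b k * \<sigma>) *\<^sub>R (tq * u ^ Suc k)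
        + (2 * real k * \<sigma>) *\<^sub>R (a k *\<^sub>R (tq * (u ^ k * X)) - b k *\<^sub>R (tq * (u ^ k * X * X)))
        = u ^ k * (a k *\<^sub>R 1 - b k *\<^sub>R X) + \<sigma> *\<^sub>R (tq * T k)"
      unfolding uXX T_def q_def \<beta>_def
      by (simp add: right_diff_distrib distrib_left scaleR_diff_right scaleR_add_right algebra_simps
          del: power_Suc)
    finally show ?thesis by (simp add: u_def)
  qed
  \<comment> \<open>Shifting the index in the \<open>u ^ Suc k\<close> parts collects equal powers;
    the leftover boundary term has order \<open>n\<close> and is harmless below.\<close>
  have sumT: "(\<Sum>k<n. T k) = (\<Sum>k<n. u ^ k * (p k *\<^sub>R 1 + q k *\<^sub>R X)) - \<beta> n *\<^sub>R u ^ n" for n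
  proof (induction n)
    case (Suc n)
    have "T n - \<beta> n *\<^sub>R u ^ n = u ^ n * (p n *\<^sub>R 1 + q n *\<^sub>R X) - \<beta> (Suc n) *\<^sub>R u ^ Suc n"
      unfolding T_def p_def by (simp add: distrib_left right_diff_distrib scaleR_diff_left del: power_Suc)
    moreover have "(\<Sum>k<Suc n. T k) = (\<Sum>k<n. u ^ k * (p k *\<^sub>R 1 + q k *\<^sub>R X)) + (T n - \<beta> n *\<^sub>R u ^ n)"
      using Suc by simp
    ultimately show ?case by simp
  qed (simp add: \<beta>_def)
  have oY: "ord_ge 1 (Y + q12)"
  proof -
    have "Y + q12 = (X + q12) + \<sigma> *\<^sub>R (tq * (1 + X * X))" by (simp add: Y)
    then show ?thesis
      by (simp only:) (intro ord_ge_add X ord_ge_scaleR ord_ge_mult_left[of _ _ tq] ord_square)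
  qed
  have "p k = 0 \<and> q k = 0" for k
  proof -
    let ?n = "Suc k"
    have "ord_ge ?n (xser a b Y - (\<Sum>k<?n. (1 + Y * Y) ^ k * (a k *\<^sub>R 1 - b k *\<^sub>R Y)))"
      unfolding xser_def by (rule fsum_approx[OF xser_term_ord[OF oY]])
    then have "ord_ge ?n (xser a b X - (\<Sum>k<?n. (1 + Y * Y) ^ k * (a k *\<^sub>R 1 - b k *\<^sub>R Y)))"
      by (simp only: eq)
    moreover have "ord_ge ?n (xser a b X - (\<Sum>k<?n. (1 + X * X) ^ k * (a k *\<^sub>R 1 - b k *\<^sub>R X)))"
      unfolding xser_def by (rule fsum_approx[OF xser_term_ord[OF X]])
    ultimately have "ord_ge ?n ((\<Sum>k<?n. (1 + Y * Y) ^ k * (a k *\<^sub>R 1 - b k *\<^sub>R Y))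
        - (\<Sum>k<?n. (1 + X * X) ^ k * (a k *\<^sub>R 1 - b k *\<^sub>R X)))"
      by (rule ord_ge_trans[OF ord_ge_sym])
    then have "ord_ge ?n (\<sigma> *\<^sub>R (tq * (\<Sum>k<?n. T k)))"
      unfolding summand sum.distrib by (simp only: add_diff_cancel_left' scaleR_sum_right sum_distrib_left)
    then have "ord_ge ?n (inverse \<sigma> *\<^sub>R (\<sigma> *\<^sub>R (tq * (\<Sum>k<?n. T k))))"
      by (rule ord_ge_scaleR)
    then have "ord_ge ?n (tq * (\<Sum>k<?n. T k))"
      using \<sigma> by (simp del: sum.lessThan_Suc)
    moreover have "ord_ge ?n (tq * (\<beta> ?n *\<^sub>R u ^ ?n))"
      unfolding u_def by (intro ord_ge_mult_left ord_ge_scaleR ord_ge_power ord_square X)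
    ultimately have "ord_ge ?n (tq * (\<Sum>k<?n. T k) + tq * (\<beta> ?n *\<^sub>R u ^ ?n))"
      by (rule ord_ge_add)
    then have "ord_ge ?n (tq * (\<Sum>k<?n. u ^ k * (p k *\<^sub>R 1 + q k *\<^sub>R X)))"
      by (simp only: sumT right_diff_distrib diff_add_cancel)
    \<comment> \<open>The specialisation \<open>\<chi>\<close> replaces \<open>X\<close> by
      \<open>xq\<close>. The sum then is a series in \<open>v0\<close> alone, so that
      \<open>tq\<close> can be cancelled and the powers are independent.\<close>
    from qhom_ord[OF \<chi>(1) this]
    have "ord_ge ?n (tq * (\<Sum>k<?n. (1 + xq * xq) ^ k * (p k *\<^sub>R 1 + q k *\<^sub>R xq)))"
      unfolding u_def by (simp only: qhom_simps(1-4,8,9)[OF \<chi>(1)] \<chi>)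
    then have "ord_ge ?n (\<Sum>k<?n. (1 + xq * xq) ^ k * (p k *\<^sub>R 1 + q k *\<^sub>R xq))"
      by (rule ord_ge_tq_cancel[rotated]) (intro v0_series_sum v0_series_power v0_series_intros)
    then show ?thesis by (rule xq_powers_independent) simp
  qed
  note pq = this[of "Suc k"]
  show "a (Suc k) = 0"
    using pq by (simp add: q_def del: of_nat_Suc)
  show "2 * real (Suc k) * b (Suc k) = (2 * real k + 1) * b k"
    using pq by (simp add: p_def \<beta>_def algebra_simps)
qed

section \<open>Uniqueness\<close>

lemma ser1_coef: "ser1 c (coef x) = coef (fsum (\<lambda>n. c n *\<^sub>R x ^ n))"
proof -
  have "apow (coef x) n = coef (x ^ n)" for n
    unfolding apow_def aprod_list_def by (induction n) (simp_all add: coef_hom)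
  then show ?thesis by (simp add: ser1_def fsum_def)
qed

lemma pol_coef:
  "pol (coef X) = coef (X * fsum (\<lambda>n. ((-1/2) gchoose n) *\<^sub>R (- (X * X) - 1) ^ n))"
  by (simp only: pol_def coef_hom ser1_coef)

lemma xser_constant:
  assumes "a 0 = 1" "\<And>k. a (Suc k) = 0" "\<And>k. b k = 0"
  shows "xser a b X = 1"
proof -
  have "(1 + X * X) ^ k * (a k *\<^sub>R 1 - b k *\<^sub>R X) = (if k = 0 then 1 else 0)" for k
    using assms by (cases k) simp_all
  then have "xser a b X = fsum (\<lambda>k. if k = 0 then 1 else 0)"
    by (simp add: xser_def)
  also have "\<dots> = 1"
    by (rule qalg_eqI) (simp add: fsum_def if_distrib[of "\<lambda>x. coef x _"] sum.delta cong: if_cong)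
  finally show ?thesis .
qed

text \<open>The recursion makes the sum of \<open>b k * u^k\<close> the binomial series of
  \<open>(1 - u)^(-1/2)\<close>. With \<open>u = 1 + X * X\<close> this is the inverse square root
  of \<open>- X * X\<close>.\<close>

lemma xser_pol:
  assumes X: "ord_ge 1 (X + q12)" and a: "\<And>k. a k = 0" and b0: "b 0 = 1"
    and b: "\<And>k. 2 * real (Suc k) * b (Suc k) = (2 * real k + 1) * b k"
  shows "coef (xser a b X) = aneg (pol (coef X))"
proof -
  let ?y = "- (X * X) - 1" and ?c = "\<lambda>n. (-1/2::real) gchoose n"
  \<comment> \<open>The sign arises because \<open>pol\<close> expands in \<open>?y\<close>, which
    is the negative of \<open>1 + X * X\<close>.\<close>
  have bk: "b k = (-1) ^ k * ?c k" for k
  proof (induction k)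
    case (Suc k)
    have "real (Suc k) * ?c (Suc k) = (-1/2 - real k) * ?c k"
      using gbinomial_mult_1[of "-1/2::real" k] by (simp add: algebra_simps)
    have "2 * real (Suc k) * ((-1) ^ Suc k * ?c (Suc k)) = - 2 * (-1) ^ k * (real (Suc k) * ?c (Suc k))"
      by simp
    also have "\<dots> = - 2 * (-1) ^ k * ((-1/2 - real k) * ?c k)"
      by (simp only: \<open>real (Suc k) * ?c (Suc k) = (-1/2 - real k) * ?c k\<close>)
    also have "\<dots> = (2 * real k + 1) * ((-1) ^ k * ?c k)"
      by (simp add: algebra_simps)
    finally have "2 * real (Suc k) * b (Suc k) = 2 * real (Suc k) * ((-1) ^ Suc k * ?c (Suc k))"
      by (simp only: b Suc)
    then show ?case by (subst (asm) mult_left_cancel) simp_all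
  qed (simp add: b0)
  have y: "ord_ge 1 ?y"
  proof -
    have "?y = - (1 + X * X)" by simp
    then show ?thesis by (simp only: ord_ge_minus[OF ord_square[OF X]])
  qed
  have "- (X * fsum (\<lambda>n. ?c n *\<^sub>R ?y ^ n)) = xser a b X"
    unfolding xser_def
  proof (rule fsum_unique[OF xser_term_ord[OF X]])
    fix n
    have "(1 + X * X) ^ k * (a k *\<^sub>R 1 - b k *\<^sub>R X) = - (X * (?c k *\<^sub>R ?y ^ k))" for k
    proof -
      have "?y = - (1 + X * X)" by simp
      moreover have "(- w) ^ k = (-1) ^ k *\<^sub>R w ^ k" for w :: qalg
        by (induction k) simp_all
      ultimately have "?y ^ k = (-1) ^ k *\<^sub>R (1 + X * X) ^ k" by (simp only:)
      moreover have "X * (1 + X * X) ^ k = (1 + X * X) ^ k * X"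
        by (rule power_commuting_commutes[symmetric]) (simp add: algebra_simps)
      ultimately show ?thesis by (simp add: a bk mult.commute)
    qed
    then have "- (X * fsum (\<lambda>n. ?c n *\<^sub>R ?y ^ n)) - (\<Sum>k<n. (1 + X * X) ^ k * (a k *\<^sub>R 1 - b k *\<^sub>R X))
        = - (X * (fsum (\<lambda>n. ?c n *\<^sub>R ?y ^ n) - (\<Sum>k<n. ?c k *\<^sub>R ?y ^ k)))"
      by (simp add: sum_negf sum_distrib_left right_diff_distrib)
    moreover have "ord_ge n (- (X * (fsum (\<lambda>n. ?c n *\<^sub>R ?y ^ n) - (\<Sum>k<n. ?c k *\<^sub>R ?y ^ k))))"
      by (intro ord_ge_minus ord_ge_mult_left fsum_approx ord_ge_scaleR ord_ge_power y)
    ultimately show "ord_ge n (- (X * fsum (\<lambda>n. ?c n *\<^sub>R ?y ^ n)) - (\<Sum>k<n. (1 + X * X) ^ k * (a k *\<^sub>R 1 - b k *\<^sub>R X)))"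
      by (simp only:)
  qed
  then show ?thesis by (simp only: pol_coef coef_hom)
qed

lemma qop_constant_term:
  assumes "ord_ge 1 (A1 - q1)" "ord_ge 1 (A2 - q2)"
  shows "ord_ge 1 (qop f p q1 q2 A1 A2 - f [] *\<^sub>R (if p then q12 else 1))"
proof -
  let ?r = "svar q1 q2 A1 A2" and ?\<kappa> = "if p then q12 else 1"
  have "words 0 = {[]}" by (auto simp: words_def)
  then have "ord_ge 1 (qser f ?r - f [] *\<^sub>R 1)"
    using fsum_approx[of _ 1, OF qser_term_ord[OF svar_ord[OF assms], of _ f]]
    by (simp add: qser_def)
  then have "ord_ge 1 ((qser f ?r - f [] *\<^sub>R 1) * ?\<kappa>)"
    by (rule ord_ge_mult_right)
  then show ?thesis by (cases p) (simp_all add: qop_def left_diff_distrib)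
qed

text \<open>The hypotheses are what left and right variance have in common: near the base point the
operation is a fixed equivariant series \<^term>\<open>F\<close> evaluated at a quotient \<^term>\<open>X\<close> of the
arguments, and rotating the arguments moves \<^term>\<open>X\<close> along \<^term>\<open>1 + X * X\<close>.\<close>

lemma variant_operation_unique:
  fixes X Y F :: qalg
  assumes oi: "op_orth_invariant f p" and f: "f [] = 1" and F: "equivariant F"
    and X: "ord_ge 1 (X + q12)" and Y: "Y = X + \<sigma> *\<^sub>R (tq * (1 + X * X))" and \<sigma>: "\<sigma> \<noteq> 0"
    and \<chi>: "qhom \<chi>" "\<chi> tq = tq" "\<chi> X = xq"
  defines "g1 \<equiv> q1 + vq 0" and "g2 \<equiv> q2 + vq 1"
    and "c \<equiv> 1 + tq * ((1/2) *\<^sub>R q12)" and "d \<equiv> 1 - tq * ((1/2) *\<^sub>R q12)"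
  assumes H: "qop f p q1 q2 g1 g2 = ev (X + q12) F"
    and H': "qop f p q1 q2 (d * (g1 + tq * g2) * c) (d * (g2 - tq * g1) * c) = ev (d * Y * c + q12) F"
  shows "coef (qop f p q1 q2 g1 g2) = (if p then aneg (pol (coef X)) else aone)"
proof -
  let ?a = "even_coef F" and ?b = "odd_coef F"
  have cd: "c * d = 1" "d * c = 1"
    unfolding c_def d_def by (rule tq_conj_inverse)+
  have HX: "qop f p q1 q2 g1 g2 = xser ?a ?b X"
    unfolding H by (rule ev_equivariant[OF F X])
  have oY: "ord_ge 1 (Y + q12)"
  proof -
    have "Y + q12 = (X + q12) + \<sigma> *\<^sub>R (tq * (1 + X * X))" by (simp add: Y)
    then show ?thesis
      by (simp only:) (intro ord_ge_add X ord_ge_scaleR ord_ge_mult_left[of _ _ tq] ord_square)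
  qed
  have "d * q12 * c = q12"
    using tq_conj[of "- ((1/2) *\<^sub>R q12)" q12] by (simp add: c_def d_def)
  then have "d * Y * c + q12 = d * (Y + q12) * c"
    by (simp add: distrib_left distrib_right)
  then have o: "ord_ge 1 (d * Y * c + q12)"
    using oY by (simp add: ord_ge_mult_left ord_ge_mult_right)
  have "d * xser ?a ?b X * c = xser ?a ?b (d * Y * c)"
    using orth_fixed_base(1)[OF oi] H' ev_equivariant[OF F o]
    unfolding HX[symmetric] g1_def g2_def c_def d_def by simp
  also have "\<dots> = d * xser ?a ?b Y * c"
    by (rule xser_hom[OF qhom_conj[OF cd(2,1)] oY, symmetric])
  \<comment> \<open>Both sides are conjugates by the same element, so the rotation of the base drops
    out and only the shift from \<open>X\<close> to \<open>Y\<close> remains.\<close>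
  finally have "c * (d * xser ?a ?b X * c) * d = c * (d * xser ?a ?b Y * c) * d"
    by simp
  moreover have "c * (d * x * c) * d = (c * d) * x * (c * d)" for x
    by (simp only: mult.assoc)
  ultimately have "xser ?a ?b X = xser ?a ?b Y"
    by (simp add: cd)
  note rec = xser_shift_coefs[OF X Y \<sigma> this \<chi>]
  have "ord_ge 1 (xser ?a ?b X - (?a 0 *\<^sub>R 1 - ?b 0 *\<^sub>R X))"
    using fsum_approx[of _ 1, OF xser_term_ord[OF X]] by (simp add: xser_def)
  from ord_ge_trans[OF ord_ge_sym[OF this] qop_constant_term[of g1 g2 f p, unfolded HX]]
  have "ord_ge 1 (?a 0 *\<^sub>R 1 - ?b 0 *\<^sub>R X - (if p then q12 else 1))"
    by (simp add: f g1_def g2_def)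
  \<comment> \<open>Adding this infinitesimal replaces \<open>X\<close> by its constant term
    \<open>- q12\<close>, so that the initial coefficients can be read off.\<close>
  then have "ord_ge 1 (?a 0 *\<^sub>R 1 - ?b 0 *\<^sub>R X - (if p then q12 else 1) + ?b 0 *\<^sub>R (X + q12))"
    by (intro ord_ge_add ord_ge_scaleR X)
  then have o1: "ord_ge 1 (?a 0 *\<^sub>R 1 + ?b 0 *\<^sub>R q12 - (if p then q12 else 1))"
    by (simp add: algebra_simps)
  have a0: "?a 0 = (if p then 0 else 1)"
    using ord_geD[OF o1, of "(False, (False, False), [])"] by (simp add: deg_def coef_one amon_def split: if_splits)
  have b0: "?b 0 = (if p then 1 else 0)"
    using ord_geD[OF o1, of "(False, (True, True), [])"] by (simp add: deg_def coef_one amon_def split: if_splits)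
  show ?thesis
  proof (cases p)
    case True
    then have "?a k = 0" for k using a0 rec(1) by (cases k) auto
    then have "coef (xser ?a ?b X) = aneg (pol (coef X))"
      using True b0 by (intro xser_pol[OF X _ _ rec(2)]) simp_all
    then show ?thesis using True HX by simp
  next
    case False
    have "?b k = 0" for k
    proof (induction k)
      case (Suc k)
      then show ?case using rec(2)[of k] by simp
    qed (use False b0 in simp)
    then have "xser ?a ?b X = 1"
      using False a0 rec(1) by (intro xser_constant) auto
    then show ?thesis using False HX by (simp add: one_qalg.rep_eq)
  qed
qed

text \<open>Left variance with \<open>\<theta>1 = 1\<close> and \<open>\<theta>2 = A2^-1 q2\<close>
  keeps the value and normalises the second argument to \<open>q2\<close>, so the operation depends
  only on \<open>A1 A2^-1\<close>. \<open>F\<close> is its value at the normalised pair with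
  quotient \<open>xq\<close>.\<close>

lemma left_variant_unique:
  assumes lv: "op_left_variant f p" and oi: "op_orth_invariant f p" and f: "f [] = 1"
  defines "g1 \<equiv> q1 + vq 0" and "g2 \<equiv> q2 + vq 1"
  shows "coef (qop f p q1 q2 g1 g2) = (if p then aneg (pol (coef (g1 * qinv g2))) else aone)"
proof -
  define F where "F = qop f p q1 q2 (xq * q2) q2"
  have near_F: "ord_ge 1 (xq * q2 - q1)" "ord_ge 1 (q2 - q2)"
    by (simp_all add: left_diff_distrib ord_ge_mult_right)
  have ev_F: "ev z F = qop f p q1 q2 ((z - q12) * q2) q2" if z: "ord_ge 1 z" for z
    unfolding F_def
    by (subst qop_natural[OF ev(1)[OF z] qunit_q near_F])
      (simp only: qhom_simps[OF ev(1)[OF z]] ev(2,3)[OF z])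
  have rep: "qop f p q1 q2 A1 A2 = ev (A1 * qinv A2 + q12) F"
    and near: "ord_ge 1 (A1 * qinv A2 + q12)"
    if A: "ord_ge 1 (A1 - q1)" "ord_ge 1 (A2 - q2)" for A1 A2
  proof -
    have inv: "A2 * qinv A2 = 1" by (rule qinv_inverse[OF qunit_near[OF qunit_q(2) A(2)]])
    show near: "ord_ge 1 (A1 * qinv A2 + q12)"
      using ord_ge_mult_cong[OF A(1) qinv_near[OF qunit_q(2) A(2)]] by simp
    have "ord_ge 1 (qinv A2 * q2 - 1)"
      using ord_ge_mult_right[OF qinv_near[OF qunit_q(2) A(2)], of q2] by (simp add: distrib_right)
    from left_variance[OF lv A _ this, of 1]
    have "qop f p q1 q2 (A1 * (qinv A2 * q2)) (A2 * (qinv A2 * q2)) = qop f p q1 q2 A1 A2"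
      by simp
    then show "qop f p q1 q2 A1 A2 = ev (A1 * qinv A2 + q12) F"
      by (simp add: ev_F[OF near] inv flip: mult.assoc)
  qed
  have F: "equivariant F"
    unfolding equivariant_def
  proof
    show "v0_series F"
      unfolding F_def by (intro v0_series_qop v0_series_intros)
    let ?c = "1 + tq * v1" and ?d = "1 - tq * v1"
    have cd: "?c * ?d = 1" "?d * ?c = 1" by (rule tq_conj_inverse)+
    have "ev (v0 + tq * (v1 * xq - xq * v1)) F = qop f p q1 q2 (?c * xq * ?d * q2) q2"
      unfolding ev_F[OF ord_conj_letter] tq_conj by (simp add: algebra_simps)
    \<comment> \<open>The right factor is \<open>q2^-1 d q2\<close>, as \<open>q2^-1 = - q2\<close>.
      Used as \<open>\<theta>2\<close> together with \<open>\<theta>1 = c\<close>, it conjugates the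
      quotient while fixing the second argument \<open>q2\<close>.\<close>
    also have "?c * xq * ?d * q2 = ?c * (xq * q2) * (- (q2 * (?d * q2)))"
    proof -
      have "?c * (xq * q2) * (- (q2 * (?d * q2))) = ?c * (xq * (q2 * (q2 * (- (?d * q2)))))"
        by (simp only: mult.assoc mult_minus_right)
      then show ?thesis by (simp only: q_mult_assoc minus_minus mult.assoc)
    qed
    also have "qop f p q1 q2 (?c * (xq * q2) * (- (q2 * (?d * q2)))) q2
        = qop f p q1 q2 (?c * (xq * q2) * (- (q2 * (?d * q2)))) (?c * q2 * (- (q2 * (?d * q2))))"
    proof -
      have "?c * q2 * (- (q2 * (?d * q2))) = ?c * (q2 * (q2 * (- (?d * q2))))"
        by (simp only: mult.assoc mult_minus_right)
      also have "\<dots> = ?c * ?d * q2" by (simp only: q_mult_assoc minus_minus mult.assoc)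
      finally show ?thesis by (simp only: cd mult_1_left)
    qed
    also have "\<dots> = ?c * F * qinv ?c"
      unfolding F_def
    proof (rule left_variance[OF lv near_F])
      show "ord_ge 1 (?c - 1)" by (simp add: ord_ge_mult_left)
      have "- (q2 * (?d * q2)) - 1 = q2 * (tq * v1 * q2)"
        by (simp add: left_diff_distrib right_diff_distrib)
      then show "ord_ge 1 (- (q2 * (?d * q2)) - 1)"
        by (simp add: ord_ge_mult_left ord_ge_mult_right)
    qed
    also have "qinv ?c = ?d" by (rule qinv_unique[OF cd])
    finally show "ev (v0 + tq * (v1 * xq - xq * v1)) F = ?c * F * ?d" .
  qed
  define X where "X = g1 * qinv g2"
  let ?c = "1 + tq * ((1/2) *\<^sub>R q12)" and ?d = "1 - tq * ((1/2) *\<^sub>R q12)"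
  have cd: "?c * ?d = 1" "?d * ?c = 1" by (rule tq_conj_inverse)+
  have g: "ord_ge 1 (g1 - q1)" "ord_ge 1 (g2 - q2)" by (simp_all add: g1_def g2_def)
  note i2 = qinv_inverse[OF qunit_near[OF qunit_q(2) g(2)]]
  \<comment> \<open>The rotated quotient: \<open>g2 - tq * g1\<close> equals
    \<open>(1 - tq * X) * g2\<close>, which gives \<open>(X + tq) * (1 + tq * X)\<close>. The scalar
    1 takes the place of \<open>\<sigma>\<close>.\<close>
  define Y where "Y = X + 1 *\<^sub>R (tq * (1 + X * X))"
  let ?R2 = "g2 - tq * g1"
  let ?I = "qinv g2 * (1 + tq * X)"
  have R2: "?R2 = (1 - tq * X) * g2"
    using i2 by (simp add: X_def left_diff_distrib mult.assoc)
  have RI: "?R2 * ?I = 1" "?I * ?R2 = 1"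
  proof -
    have "?R2 * ?I = (1 - tq * X) * (g2 * qinv g2) * (1 + tq * X)" by (simp only: R2 mult.assoc)
    then show "?R2 * ?I = 1" using i2 tq_conj_inverse(2)[of X] by simp
    have "?I * ?R2 = qinv g2 * ((1 + tq * X) * (1 - tq * X)) * g2" by (simp only: R2 mult.assoc)
    then show "?I * ?R2 = 1" using i2 tq_conj_inverse(1)[of X] by simp
  qed
  have Y: "(g1 + tq * g2) * ?I = Y"
  proof -
    have "(g1 + tq * g2) * ?I = (g1 * qinv g2 + tq * (g2 * qinv g2)) * (1 + tq * X)"
      by (simp only: distrib_right mult.assoc)
    also have "\<dots> = (X + tq) * (1 + tq * X)" by (simp add: i2 X_def)
    also have "\<dots> = Y"
      by (simp add: Y_def distrib_left distrib_right tq_left_commute[of X X])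
    finally show ?thesis .
  qed
  have conj_inv: "qinv (?d * ?R2 * ?c) = ?d * ?I * ?c"
  proof (rule qinv_unique)
    have "?d * ?R2 * ?c * (?d * ?I * ?c) = ?d * (?R2 * ((?c * ?d) * ?I)) * ?c"
      "?d * ?I * ?c * (?d * ?R2 * ?c) = ?d * (?I * ((?c * ?d) * ?R2)) * ?c"
      by (simp_all only: mult.assoc)
    then show "?d * ?R2 * ?c * (?d * ?I * ?c) = 1" "?d * ?I * ?c * (?d * ?R2 * ?c) = 1"
      by (simp_all only: cd RI mult_1_left mult_1_right)
  qed
  have conj_Y: "?d * (g1 + tq * g2) * ?c * qinv (?d * ?R2 * ?c) = ?d * Y * ?c"
  proof -
    have "?d * (g1 + tq * g2) * ?c * (?d * ?I * ?c) = ?d * ((g1 + tq * g2) * ((?c * ?d) * ?I)) * ?c"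
      by (simp only: mult.assoc)
    then show ?thesis by (simp only: conj_inv cd Y mult_1_left)
  qed
  \<comment> \<open>Specialising \<open>R1\<close> to \<open>v0 * q2\<close> and \<open>R2\<close>
    to 0 makes the quotient \<open>(q1 + v0 * q2) * q2^-1\<close>, which is
    \<open>xq\<close>.\<close>
  have oz: "ord_ge 1 (v0 * q2)" "ord_ge 1 0" by (simp_all add: ord_ge_mult_right)
  note s = subst4[OF oz(1) oz(2) oz(2) oz(2)]
  have chi: "subst4 (v0 * q2) 0 0 0 X = xq"
  proof -
    have "subst4 (v0 * q2) 0 0 0 X = (q1 + v0 * q2) * qinv (q2 + 0)"
      using qhom_qinv[OF s(1) qunit_near[OF qunit_q(2) g(2)]]
      by (simp add: X_def g1_def g2_def qhom_simps[OF s(1)] s)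
    also have "\<dots> = xq" by (simp add: distrib_right mult.assoc)
    finally show ?thesis .
  qed
  note orth = orth_fixed_base(2,3)[OF oi, folded g1_def g2_def]
  have "coef (qop f p q1 q2 (q1 + vq 0) (q2 + vq 1)) = (if p then aneg (pol (coef X)) else aone)"
  proof (rule variant_operation_unique[OF oi f F _ Y_def _ s(1) s(3) chi])
    show "ord_ge 1 (X + q12)" using near[OF g] by (simp add: X_def)
    show "qop f p q1 q2 (q1 + vq 0) (q2 + vq 1) = ev (X + q12) F"
      using rep[OF g] by (simp add: X_def g1_def g2_def)
    show "qop f p q1 q2 (?d * (q1 + vq 0 + tq * (q2 + vq 1)) * ?c)
        (?d * (q2 + vq 1 - tq * (q1 + vq 0)) * ?c) = ev (?d * Y * ?c + q12) F"
      using rep[OF orth] unfolding conj_Y unfolding g1_def g2_def .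
  qed simp
  then show ?thesis by (simp only: X_def g1_def g2_def)
qed

text \<open>Here the first argument is normalised to \<open>q1\<close>, by
  \<open>\<theta>1 = q1 A1^-1\<close> and \<open>\<theta>2 = 1\<close>, so the operation depends
  only on \<open>A1^-1 A2\<close>.\<close>

lemma right_variant_unique:
  assumes rv: "op_right_variant f p" and oi: "op_orth_invariant f p" and f: "f [] = 1"
  defines "g1 \<equiv> q1 + vq 0" and "g2 \<equiv> q2 + vq 1"
  shows "coef (qop f p q1 q2 g1 g2) = (if p then aneg (pol (coef (qinv g1 * g2))) else aone)"
proof -
  define F where "F = qop f p q1 q2 q1 (q1 * xq)"
  have near_F: "ord_ge 1 (q1 - q1)" "ord_ge 1 (q1 * xq - q2)"
    by (simp_all add: right_diff_distrib ord_ge_mult_left)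
  have ev_F: "ev z F = qop f p q1 q2 q1 (q1 * (z - q12))" if z: "ord_ge 1 z" for z
    unfolding F_def
    by (subst qop_natural[OF ev(1)[OF z] qunit_q near_F])
      (simp only: qhom_simps[OF ev(1)[OF z]] ev(2,3)[OF z])
  have rep: "qop f p q1 q2 A1 A2 = ev (qinv A1 * A2 + q12) F"
    and near: "ord_ge 1 (qinv A1 * A2 + q12)"
    if A: "ord_ge 1 (A1 - q1)" "ord_ge 1 (A2 - q2)" for A1 A2
  proof -
    have inv: "qinv A1 * A1 = 1" by (rule qinv_inverse[OF qunit_near[OF qunit_q(1) A(1)]])
    show near: "ord_ge 1 (qinv A1 * A2 + q12)"
      using ord_ge_mult_cong[OF qinv_near[OF qunit_q(1) A(1)] A(2)] by simp
    have "ord_ge 1 (q1 * qinv A1 - 1)"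
      using ord_ge_mult_left[OF qinv_near[OF qunit_q(1) A(1)], of q1] by (simp add: distrib_left)
    from right_variance[OF rv A this, of 1]
    have "qop f p q1 q2 (q1 * qinv A1 * A1) (q1 * qinv A1 * A2) = qop f p q1 q2 A1 A2"
      by simp
    then show "qop f p q1 q2 A1 A2 = ev (qinv A1 * A2 + q12) F"
      by (simp add: ev_F[OF near] inv mult.assoc)
  qed
  have F: "equivariant F"
    unfolding equivariant_def
  proof
    show "v0_series F"
      unfolding F_def by (intro v0_series_qop v0_series_intros)
    let ?c = "1 + tq * v1" and ?d = "1 - tq * v1"
    have cd: "?c * ?d = 1" "?d * ?c = 1" by (rule tq_conj_inverse)+
    \<comment> \<open>This is \<open>q1 c q1^-1\<close>. As \<open>\<theta>1\<close>, with
      \<open>\<theta>2 = d\<close>, it fixes the first argument \<open>q1\<close> and conjugates the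
      quotient by \<open>c\<close>.\<close>
    let ?\<theta> = "- (q1 * ?c * q1)"
    have \<theta>: "?\<theta> * (q1 * x) * ?d = q1 * (?c * x * ?d)" for x
    proof -
      have "?\<theta> * (q1 * x) * ?d = - (q1 * (?c * (q1 * (q1 * (x * ?d)))))"
        by (simp only: mult.assoc mult_minus_left)
      then show ?thesis by (simp only: q_mult_assoc mult_minus_right minus_minus mult.assoc)
    qed
    have "ev (v0 + tq * (v1 * xq - xq * v1)) F = qop f p q1 q2 q1 (q1 * (?c * xq * ?d))"
      unfolding ev_F[OF ord_conj_letter] tq_conj by (simp add: algebra_simps)
    also have "\<dots> = qop f p q1 q2 (?\<theta> * q1 * ?d) (?\<theta> * (q1 * xq) * ?d)"
      using \<theta>[of 1] by (simp only: \<theta> mult_1_right cd)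
    also have "\<dots> = qinv ?d * F * ?d"
      unfolding F_def
    proof (rule right_variance[OF rv near_F])
      show "ord_ge 1 (?d - 1)" by (simp add: ord_ge_mult_left ord_ge_minus)
      have "?\<theta> - 1 = - (q1 * (tq * v1) * q1)"
        by (simp add: distrib_left distrib_right)
      then show "ord_ge 1 (?\<theta> - 1)"
        by (simp add: ord_ge_mult_left ord_ge_mult_right ord_ge_minus)
    qed
    also have "qinv ?d = ?c" by (rule qinv_unique[OF cd(2,1)])
    finally show "ev (v0 + tq * (v1 * xq - xq * v1)) F = ?c * F * ?d" .
  qed
  define X where "X = qinv g1 * g2"
  let ?c = "1 + tq * ((1/2) *\<^sub>R q12)" and ?d = "1 - tq * ((1/2) *\<^sub>R q12)"
  have cd: "?c * ?d = 1" "?d * ?c = 1" by (rule tq_conj_inverse)+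
  have g: "ord_ge 1 (g1 - q1)" "ord_ge 1 (g2 - q2)" by (simp_all add: g1_def g2_def)
  note i1 = qinv_inverse[OF qunit_near[OF qunit_q(1) g(1)]]
  \<comment> \<open>Now \<open>g1 + tq * g2\<close> equals \<open>g1 * (1 + tq * X)\<close>, and the
    rotated quotient \<open>(1 - tq * X) * (X - tq)\<close> moves in the opposite direction, hence
    \<open>\<sigma> = -1\<close>.\<close>
  define Y where "Y = X + (- 1) *\<^sub>R (tq * (1 + X * X))"
  let ?R1 = "g1 + tq * g2"
  let ?I = "(1 - tq * X) * qinv g1"
  have R1: "?R1 = g1 * (1 + tq * X)"
    using i1 tq_left_commute[of g1 X] by (simp add: X_def distrib_left flip: mult.assoc[of g1 "qinv g1"])
  have RI: "?R1 * ?I = 1" "?I * ?R1 = 1"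
  proof -
    have "?R1 * ?I = g1 * ((1 + tq * X) * (1 - tq * X)) * qinv g1" by (simp only: R1 mult.assoc)
    then show "?R1 * ?I = 1" using i1 tq_conj_inverse(1)[of X] by simp
    have "?I * ?R1 = (1 - tq * X) * (qinv g1 * g1) * (1 + tq * X)" by (simp only: R1 mult.assoc)
    then show "?I * ?R1 = 1" using i1 tq_conj_inverse(2)[of X] by simp
  qed
  have Y: "?I * (g2 - tq * g1) = Y"
  proof -
    have "?I * (g2 - tq * g1) = (1 - tq * X) * (qinv g1 * g2 - tq * (qinv g1 * g1))"
      by (simp only: right_diff_distrib mult.assoc tq_left_commute[of "qinv g1" g1])
    also have "\<dots> = (1 - tq * X) * (X - tq)" by (simp add: i1 X_def)
    also have "\<dots> = Y"
      using tq_mult_tq[of X 1]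
      by (simp add: Y_def left_diff_distrib right_diff_distrib distrib_left mult.assoc)
    finally show ?thesis .
  qed
  have conj_inv: "qinv (?d * ?R1 * ?c) = ?d * ?I * ?c"
  proof (rule qinv_unique)
    have "?d * ?R1 * ?c * (?d * ?I * ?c) = ?d * (?R1 * ((?c * ?d) * ?I)) * ?c"
      "?d * ?I * ?c * (?d * ?R1 * ?c) = ?d * (?I * ((?c * ?d) * ?R1)) * ?c"
      by (simp_all only: mult.assoc)
    then show "?d * ?R1 * ?c * (?d * ?I * ?c) = 1" "?d * ?I * ?c * (?d * ?R1 * ?c) = 1"
      by (simp_all only: cd RI mult_1_left mult_1_right)
  qed
  have conj_Y: "qinv (?d * ?R1 * ?c) * (?d * (g2 - tq * g1) * ?c) = ?d * Y * ?c"
  proof -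
    have "?d * ?I * ?c * (?d * (g2 - tq * g1) * ?c) = ?d * (?I * ((?c * ?d) * (g2 - tq * g1))) * ?c"
      by (simp only: mult.assoc)
    then show ?thesis by (simp only: conj_inv cd Y mult_1_left)
  qed
  \<comment> \<open>Specialising \<open>R1\<close> to 0 and \<open>R2\<close> to
    \<open>q1 * v0\<close> makes the quotient \<open>q1^-1 * (q2 + q1 * v0)\<close>, which is
    \<open>xq\<close>.\<close>
  have oz: "ord_ge 1 (q1 * v0)" "ord_ge 1 0" by (simp_all add: ord_ge_mult_left)
  note s = subst4[OF oz(2) oz(1) oz(2) oz(2)]
  have chi: "subst4 0 (q1 * v0) 0 0 X = xq"
  proof -
    have "subst4 0 (q1 * v0) 0 0 X = qinv (q1 + 0) * (q2 + q1 * v0)"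
      using qhom_qinv[OF s(1) qunit_near[OF qunit_q(1) g(1)]]
      by (simp add: X_def g1_def g2_def qhom_simps[OF s(1)] s)
    also have "\<dots> = xq" by (simp add: distrib_left)
    finally show ?thesis .
  qed
  note orth = orth_fixed_base(2,3)[OF oi, folded g1_def g2_def]
  have "coef (qop f p q1 q2 (q1 + vq 0) (q2 + vq 1)) = (if p then aneg (pol (coef X)) else aone)"
  proof (rule variant_operation_unique[OF oi f F _ Y_def _ s(1) s(3) chi])
    show "ord_ge 1 (X + q12)" using near[OF g] by (simp add: X_def)
    show "qop f p q1 q2 (q1 + vq 0) (q2 + vq 1) = ev (X + q12) F"
      using rep[OF g] by (simp add: X_def g1_def g2_def)
    show "qop f p q1 q2 (?d * (q1 + vq 0 + tq * (q2 + vq 1)) * ?c)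
        (?d * (q2 + vq 1 - tq * (q1 + vq 0)) * ?c) = ev (?d * Y * ?c + q12) F"
      using rep[OF orth] unfolding conj_Y unfolding g1_def g2_def .
  qed simp
  then show ?thesis by (simp only: X_def g1_def g2_def)
qed

theorem mainTheorem5:
  shows "(\<forall>f0 :: ncser. f0 [] = 1 \<and> orth_invariant (sc_op f0)
            \<and> (left_variant (sc_op f0) \<or> right_variant (sc_op f0))
            \<longrightarrow> sc_op f0 aQ1 aQ2 gA1 gA2 = aone)
       \<and> (\<forall>f12 :: ncser. f12 [] = 1 \<and> orth_invariant (ps_op f12) \<and> left_variant (ps_op f12)
            \<longrightarrow> ps_op f12 aQ1 aQ2 gA1 gA2 = aneg (pol (gA1 \<otimes> ainv gA2)))
       \<and> (\<forall>f12 :: ncser. f12 [] = 1 \<and> orth_invariant (ps_op f12) \<and> right_variant (ps_op f12)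
            \<longrightarrow> ps_op f12 aQ1 aQ2 gA1 gA2 = aneg (pol (ainv gA1 \<otimes> gA2)))"
  unfolding orth_invariant_coef left_variant_coef right_variant_coef generators_coef
    sc_op_coef ps_op_coef ainv_coef coef_hom(4)
  using left_variant_unique right_variant_unique by auto

end
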